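(* Let $\mathbb{F}$ be an arbitrary field and let $\mathcal{T}\in\mathbb{F}^{d_1\times\cdots\times d_n}$ have multilinear rank $(r_1,\dots,r_n)$. For each $i\in\{1,\dots,n\}$ let $I_i\subset\{1,\dots,d_i\}$. Set $\mathcal{R}=\mathcal{T}(I_1,\dots,I_n)$, $C_i=\mathcal{T}_{(i)}(:,\otimes_{j\neq i}I_j)$, and $U_i=C_i(I_i,:)=\mathcal{R}_{(i)}$. Then the following are equivalent: (i) $\operatorname{rank}(U_i)=r_i$ for all $i=1,\dots,n$; (ii) $\mathcal{T}=\mathcal{R}\times_1(C_1U_1^\sim)\times_2\cdots\times_n(C_nU_n^\sim)$ for some generalized inverses $U_1^\sim,\dots,U_n^\sim$ of $U_1,\dots,U_n$; (iii) $\mathcal{T}=\mathcal{R}\times_1(C_1U_1^\sim)\times_2\cdots\times_n(C_nU_n^\sim)$ for all generalized inverses $U_1^\sim,\dots,U_n^\sim$ of $U_1,\dots,U_n$; (iv) the multilinear rank of $\mathcal{R}$ is $(r_1,\dots,r_n)$. If any of the equivalent statements (i)--(iv) hold, then $\mathcal{T}=\mathcal{T}\times_1(C_1C_1^\sim)\times_2\cdots\times_n(C_nC_n^\sim)$ for all generalized inverses $C_1^\sim,\dots,C_n^\sim$ of $C_1,\dots,C_n$. Moreover, if any of the equivalent statements (i)--(iv) hold, then (v) $\operatorname{rank}(\mathcal{T}_{(i)}(I_i,:))=r_i$ for all $i=1,\dots,n$. If $\mathbb{F}=\mathbb{R}$ or $\mathbb{C}$, then (v) is equivalent to each of the conditions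 (i)--(iv).
   Context: A generalized inverse of a matrix $M\in\mathbb{F}^{p\times q}$ is any $M^\sim\in\mathbb{F}^{q\times p}$ with $MM^\sim M=M$. $M(I,:)$ and $M(:,J)$ denote the submatrices of rows indexed by $I$ and of columns indexed by $J$. For a tensor $\mathcal{T}\in\mathbb{F}^{d_1\times\cdots\times d_n}$, its mode-$i$ unfolding is the matrix $\mathcal{T}_{(i)}\in\mathbb{F}^{d_i\times\prod_{j\neq i}d_j}$ whose row index is the $i$-th tensor index and whose columns are indexed by the remaining indices, via a fixed bijection between $\prod_{j\ne i}\{1,\dots,d_j\}$ and $\{1,\dots,\prod_{j\neq i}d_j\}$. $\otimes_{j\neq i}I_j$ denotes the set of column indices of $\mathcal{T}_{(i)}$ corresponding to $\prod_{j\neq i}I_j$ under this bijection; thus $C_i$ is the mode-$i$ unfolding of the subtensor $\mathcal{T}(I_1,\dots,I_{i-1},:,I_{i+1},\dots,I_n)$ (all values allowed for the $i$-th index, the $j$-th index in $I_j$ for $j\ne i$). For $Y\in\mathbb{F}^{m\times d_i}$, the mode-$i$ product $\mathcal{T}\times_iY$ is the tensor of size $d_1\times\cdots\times d_{i-1}\times m\times d_{i+1}\times\cdots\times d_n$ determined by $(\mathcal{T}\times_iY)_{(i)}=Y\mathcal{T}_{(i)}$. $\mathcal{T}$ has multilinear rank $(r_1,\dots,r_n)$ if $\operatorname{rank}(\mathcal{T}_{(i)})=r_i$ for all $i$. $\mathcal{T}(I_1,\dots,I_n)$ is the subtensor of entries whose $j$-th index lies in $I_j$ for every $j$. *)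

theory Defs
  imports
    "HOL-Library.FuncSet"
    "Jordan_Normal_Form.DL_Rank"
    "Jordan_Normal_Form.DL_Submatrix"
begin

abbreviation mat_rank :: "'a::field mat \<Rightarrow> nat" where
  "mat_rank A \<equiv> vec_space.rank (dim_row A) A"

definition is_generalized_inverse :: "'a::field mat \<Rightarrow> 'a mat \<Rightarrow> bool" where
  "is_generalized_inverse M G \<longleftrightarrow> G \<in> carrier_mat (dim_col M) (dim_row M) \<and> M * G * M = M"


section \<open>Tensors of arbitrary order\<close>

text \<open>As for matrices, indices and modes are counted from 0: the multi-indices of a tensor of
  size \<open>[d\<^sub>0, \<dots>, d\<^sub>n\<^sub>-\<^sub>1]\<close> are the lists \<open>[k\<^sub>0, \<dots>, k\<^sub>n\<^sub>-\<^sub>1]\<close> with \<open>k\<^sub>j < d\<^sub>j\<close>.\<close>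

definition multi_indices :: "nat list \<Rightarrow> nat list set" where
  "multi_indices ds = listset (map (\<lambda>d. {..<d}) ds)"

text \<open>Entries outside the multi-indices are \<open>undefined\<close>, so that \<open>=\<close> is equality of tensors.\<close>

typedef 'a tensor = "{(ds :: nat list, f :: nat list \<Rightarrow> 'a). f \<in> extensional (multi_indices ds)}"
  by (intro exI[of _ "(_, \<lambda>_. undefined)"]) (simp add: extensional_def)

definition dims :: "'a tensor \<Rightarrow> nat list" where
  "dims T = fst (Rep_tensor T)"

definition entry :: "'a tensor \<Rightarrow> nat list \<Rightarrow> 'a" where
  "entry T = snd (Rep_tensor T)"

definition mk_tensor :: "nat list \<Rightarrow> (nat list \<Rightarrow> 'a) \<Rightarrow> 'a tensor" where
  "mk_tensor ds f = Abs_tensor (ds, restrict f (multi_indices ds))"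

lemma Rep_mk_tensor: "Rep_tensor (mk_tensor ds f) = (ds, restrict f (multi_indices ds))"
  unfolding mk_tensor_def by (rule Abs_tensor_inverse) simp

lemma dims_mk_tensor [simp]: "dims (mk_tensor ds f) = ds"
  by (simp add: dims_def Rep_mk_tensor)

lemma entry_mk_tensor [simp]: "is \<in> multi_indices ds \<Longrightarrow> entry (mk_tensor ds f) is = f is"
  by (simp add: entry_def Rep_mk_tensor)

lemma tensor_eqI:
  assumes "dims S = dims T"
    and "\<And>is. is \<in> multi_indices (dims T) \<Longrightarrow> entry S is = entry T is"
  shows "S = T"
proof -
  have ext: "entry X \<in> extensional (multi_indices (dims X))" for X :: "'a tensor"
    using Rep_tensor[of X] by (auto simp: entry_def dims_def)
  have "entry S = entry T"
    using ext[of S] ext[of T] assms by (metis extensionalityI)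
  then show ?thesis
    using assms(1) by (metis Rep_tensor_inject dims_def entry_def prod.expand)
qed

text \<open>The subtensor \<open>T(I\<^sub>0, \<dots>, I\<^sub>n\<^sub>-\<^sub>1)\<close>. As in \<^const>\<open>submatrix\<close>, \<open>pick I k\<close> is the \<open>k\<close>-th
  smallest element of \<open>I\<close>.\<close>

definition subtensor :: "'a tensor \<Rightarrow> nat set list \<Rightarrow> 'a tensor" where
  "subtensor T Is =
     mk_tensor (map2 (\<lambda>d I. card {k. k < d \<and> k \<in> I}) (dims T) Is)
               (\<lambda>ks. entry T (map2 pick Is ks))"


section \<open>Unfoldings\<close>

definition del_nth :: "nat \<Rightarrow> 'b list \<Rightarrow> 'b list" where
  "del_nth i xs = take i xs @ drop (Suc i) xs"

definition ins_nth :: "nat \<Rightarrow> 'b \<Rightarrow> 'b list \<Rightarrow> 'b list" where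
  "ins_nth i x xs = take i xs @ x # drop i xs"

text \<open>The choice of bijections between multi-indices and column numbers: \<open>\<beta> i es\<close> numbers the
  columns of the mode-\<open>i\<close> unfolding of a tensor whose sizes, with the \<open>i\<close>-th one deleted,
  are \<open>es\<close>.\<close>

type_synonym column_numbering = "nat \<Rightarrow> nat list \<Rightarrow> nat list \<Rightarrow> nat"

definition is_column_numbering :: "column_numbering \<Rightarrow> bool" where
  "is_column_numbering \<beta> \<longleftrightarrow>
     (\<forall>i es. bij_betw (\<beta> i es) (multi_indices es) {..<prod_list es})"

definition unfolding_mat :: "column_numbering \<Rightarrow> nat \<Rightarrow> 'a tensor \<Rightarrow> 'a mat" where
  "unfolding_mat \<beta> i T =
     (let es = del_nth i (dims T) in
      mat (dims T ! i) (prod_list es)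
        (\<lambda>(k, c). entry T (ins_nth i k (inv_into (multi_indices es) (\<beta> i es) c))))"

text \<open>The set of column numbers corresponding to the product of the \<open>I\<^sub>j\<close> with \<open>j \<noteq> i\<close>.\<close>

definition column_set :: "column_numbering \<Rightarrow> nat \<Rightarrow> 'a tensor \<Rightarrow> nat set list \<Rightarrow> nat set" where
  "column_set \<beta> i T Is = \<beta> i (del_nth i (dims T)) ` listset (del_nth i Is)"

definition multilinear_rank :: "column_numbering \<Rightarrow> 'a::field tensor \<Rightarrow> nat list" where
  "multilinear_rank \<beta> T = map (\<lambda>i. mat_rank (unfolding_mat \<beta> i T)) [0..<length (dims T)]"

text \<open>The mode-\<open>i\<close> product is the tensor with mode-\<open>i\<close> unfolding \<open>Y * unfolding_mat \<beta> i T\<close>; see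
  \<open>unfolding_mode_product\<close> and \<open>mode_product_unique\<close> below.\<close>

definition mode_product :: "column_numbering \<Rightarrow> nat \<Rightarrow> 'a::field tensor \<Rightarrow> 'a mat \<Rightarrow> 'a tensor" where
  "mode_product \<beta> i T Y =
     mk_tensor ((dims T)[i := dim_row Y])
       (\<lambda>is. (Y * unfolding_mat \<beta> i T) $$ (is ! i, \<beta> i (del_nth i (dims T)) (del_nth i is)))"

text \<open>\<open>T \<times>\<^sub>0 Y\<^sub>0 \<times>\<^sub>1 \<dots> \<times>\<^sub>n\<^sub>-\<^sub>1 Y\<^sub>n\<^sub>-\<^sub>1\<close>, evaluated from left to right.\<close>

definition multi_mode_product ::
    "column_numbering \<Rightarrow> 'a::field tensor \<Rightarrow> (nat \<Rightarrow> 'a mat) \<Rightarrow> 'a tensor" where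
  "multi_mode_product \<beta> T Y = fold (\<lambda>i S. mode_product \<beta> i S (Y i)) [0..<length (dims T)] T"


section \<open>Sanity checks\<close>

lemma mem_listset: "is \<in> listset As \<longleftrightarrow> list_all2 (\<in>) is As"
  by (induction As arbitrary: "is") (auto simp: set_Cons_def list_all2_Cons2)

lemma mem_multi_indices:
  "is \<in> multi_indices ds \<longleftrightarrow> length is = length ds \<and> (\<forall>j<length ds. is ! j < ds ! j)"
  by (auto simp: multi_indices_def mem_listset list_all2_conv_all_nth)

lemma length_del_nth [simp]: "i < length xs \<Longrightarrow> length (del_nth i xs) = length xs - 1"
  by (auto simp: del_nth_def)

lemma nth_del_nth:
  "i < length xs \<Longrightarrow> j < length xs - 1 \<Longrightarrow> del_nth i xs ! j = (if j < i then xs ! j else xs ! Suc j)"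
  by (auto simp: del_nth_def nth_append min_def)

lemma del_nth_ins_nth [simp]: "i \<le> length xs \<Longrightarrow> del_nth i (ins_nth i x xs) = xs"
  by (auto simp: del_nth_def ins_nth_def min_def)

lemma nth_ins_nth [simp]: "i \<le> length xs \<Longrightarrow> ins_nth i x xs ! i = x"
  by (auto simp: ins_nth_def nth_append min_def)

lemma ins_nth_del_nth [simp]: "i < length xs \<Longrightarrow> ins_nth i (xs ! i) (del_nth i xs) = xs"
  by (auto simp: del_nth_def ins_nth_def min_def id_take_nth_drop[symmetric])

lemma del_nth_update [simp]: "del_nth i (xs[i := x]) = del_nth i xs"
  by (auto simp: del_nth_def)

lemma multi_indices_ins_nth:
  assumes "i < length ds" "k < ds ! i" "js \<in> multi_indices (del_nth i ds)"
  shows "ins_nth i k js \<in> multi_indices ds"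
proof -
  have "list_all2 (\<in>) js (map (\<lambda>d. {..<d}) (take i ds) @ map (\<lambda>d. {..<d}) (drop (Suc i) ds))"
    using assms(3) by (simp add: multi_indices_def mem_listset del_nth_def)
  then obtain us vs where js: "js = us @ vs"
    and us: "list_all2 (\<in>) us (map (\<lambda>d. {..<d}) (take i ds))"
    and vs: "list_all2 (\<in>) vs (map (\<lambda>d. {..<d}) (drop (Suc i) ds))"
    by (auto simp: list_all2_append2)
  have len: "length us = i"
    using us assms(1) by (auto dest: list_all2_lengthD)
  have "list_all2 (\<in>) (us @ k # vs)
      (map (\<lambda>d. {..<d}) (take i ds) @ {..<ds ! i} # map (\<lambda>d. {..<d}) (drop (Suc i) ds))"
    using us vs assms(2) by (intro list_all2_appendI) auto
  also have "map (\<lambda>d. {..<d}) (take i ds) @ {..<ds ! i} # map (\<lambda>d. {..<d}) (drop (Suc i) ds)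
      = map (\<lambda>d. {..<d}) ds"
    using id_take_nth_drop[OF assms(1)] by (metis list.simps(9) map_append)
  finally show ?thesis
    using len by (simp add: js ins_nth_def multi_indices_def mem_listset)
qed

lemma multi_indices_del_nth:
  assumes "i < length ds" "is \<in> multi_indices ds"
  shows "del_nth i is \<in> multi_indices (del_nth i ds)"
  using assms by (auto simp: mem_multi_indices nth_del_nth)

lemma finite_multi_indices: "finite (multi_indices ds)"
  and card_multi_indices: "card (multi_indices ds) = prod_list ds"
proof (induction ds)
  case Nil
  { case 1 show ?case by (simp add: multi_indices_def) }
  { case 2 show ?case by (simp add: multi_indices_def) }
next
  case (Cons d ds)
  have eq: "multi_indices (d # ds) = (\<lambda>(x, xs). x # xs) ` ({..<d} \<times> multi_indices ds)"
    by (auto simp: multi_indices_def set_Cons_def)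
  { case 1 show ?case using Cons(1) by (simp add: eq) }
  { case 2 show ?case
      unfolding eq by (subst card_image) (auto simp: inj_on_def card_cartesian_product Cons(2)) }
qed

lemma column_numbering_exists: "\<exists>\<beta>. is_column_numbering \<beta>"
proof -
  have "\<exists>f. bij_betw f (multi_indices es) {..<prod_list es}" for es
    by (rule finite_same_card_bij) (auto simp: finite_multi_indices card_multi_indices)
  then obtain f where "\<And>es. bij_betw (f es) (multi_indices es) {..<prod_list es}"
    by metis
  then show ?thesis
    by (intro exI[of _ "\<lambda>_. f"]) (simp add: is_column_numbering_def)
qed

lemma dims_mode_product: "dims (mode_product \<beta> i T Y) = (dims T)[i := dim_row Y]"
  by (simp add: mode_product_def)

lemma unfolding_mode_product:
  assumes \<beta>: "is_column_numbering \<beta>" and i: "i < length (dims T)"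
  shows "unfolding_mat \<beta> i (mode_product \<beta> i T Y) = Y * unfolding_mat \<beta> i T"
proof -
  define es where "es = del_nth i (dims T)"
  have bij: "bij_betw (\<beta> i es) (multi_indices es) {..<prod_list es}"
    using \<beta> by (simp add: is_column_numbering_def)
  have len: "length es = length (dims T) - 1"
    using i by (simp add: es_def)
  show ?thesis
  proof (rule eq_matI)
    fix k c
    assume "k < dim_row (Y * unfolding_mat \<beta> i T)" "c < dim_col (Y * unfolding_mat \<beta> i T)"
    then have k: "k < dim_row Y" and c: "c < prod_list es"
      by (auto simp: unfolding_mat_def Let_def es_def)
    define js where "js = inv_into (multi_indices es) (\<beta> i es) c"
    have js: "js \<in> multi_indices es" "\<beta> i es js = c"
      using bij c unfolding js_def bij_betw_def by (auto intro: inv_into_into f_inv_into_f)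
    have il: "i \<le> length js"
      using js(1) len i by (auto simp: mem_multi_indices)
    have "ins_nth i k js \<in> multi_indices ((dims T)[i := dim_row Y])"
      using js(1) k i by (intro multi_indices_ins_nth) (auto simp: es_def)
    then have "entry (mode_product \<beta> i T Y) (ins_nth i k js)
        = (Y * unfolding_mat \<beta> i T) $$ (k, c)"
      using il js(2) by (simp add: mode_product_def es_def)
    then show "unfolding_mat \<beta> i (mode_product \<beta> i T Y) $$ (k, c)
        = (Y * unfolding_mat \<beta> i T) $$ (k, c)"
      using k c i
      by (simp add: unfolding_mat_def[of \<beta> i "mode_product \<beta> i T Y"] Let_def dims_mode_product
          js_def es_def)
  qed (use i in \<open>auto simp: unfolding_mat_def mode_product_def Let_def\<close>)
qed

lemma mode_product_unique:
  assumes \<beta>: "is_column_numbering \<beta>" and i: "i < length (dims T)"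
    and dims: "dims S = (dims T)[i := dim_row Y]"
    and unf: "unfolding_mat \<beta> i S = Y * unfolding_mat \<beta> i T"
  shows "S = mode_product \<beta> i T Y"
proof (rule tensor_eqI)
  show "dims S = dims (mode_product \<beta> i T Y)"
    by (simp add: mode_product_def dims)
next
  fix "is" assume "is \<in> multi_indices (dims (mode_product \<beta> i T Y))"
  then have is1: "is \<in> multi_indices ((dims T)[i := dim_row Y])"
    by (simp add: mode_product_def)
  define es where "es = del_nth i (dims T)"
  define js where "js = del_nth i is"
  have bij: "bij_betw (\<beta> i es) (multi_indices es) {..<prod_list es}"
    using \<beta> by (simp add: is_column_numbering_def)
  have js: "js \<in> multi_indices es"
    using multi_indices_del_nth[OF _ is1, of i] i by (simp add: js_def es_def)
  have c: "\<beta> i es js < prod_list es" "inv_into (multi_indices es) (\<beta> i es) (\<beta> i es js) = js"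
    using bij js by (auto simp: bij_betw_def inv_into_f_f)
  have k: "is ! i < dim_row Y" and il: "i < length is"
    using is1 i by (auto simp: mem_multi_indices dest!: spec[of _ i])
  have "entry S is = entry S (ins_nth i (is ! i) js)"
    using il by (simp add: js_def)
  also have "\<dots> = unfolding_mat \<beta> i S $$ (is ! i, \<beta> i es js)"
    using c k i by (simp add: unfolding_mat_def Let_def dims es_def)
  also have "\<dots> = entry (mode_product \<beta> i T Y) is"
    using is1 by (simp add: unf mode_product_def js_def es_def)
  finally show "entry S is = entry (mode_product \<beta> i T Y) is" .
qed

lemma map2_ins_nth:
  assumes "i < length xs" "length ys = length xs - 1"
  shows "map2 f xs (ins_nth i y ys) = ins_nth i (f (xs ! i) y) (map2 f (del_nth i xs) ys)"
proof -
  define us vs as bs where "us = take i xs" "vs = drop (Suc i) xs" "as = take i ys" "bs = drop i ys"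
  note defs = this
  have xs: "xs = us @ xs ! i # vs" and ys: "ys = as @ bs"
    using id_take_nth_drop[OF assms(1)] by (simp_all add: defs)
  have len: "length us = i" "length as = i" "length vs = length bs"
    using assms by (auto simp: defs)
  have "map2 f xs (ins_nth i y ys) = map2 f (us @ xs ! i # vs) (as @ y # bs)"
    using xs by (metis ins_nth_def defs(3,4))
  also have "\<dots> = ins_nth i (f (xs ! i) y) (map2 f (us @ vs) (as @ bs))"
    using len by (simp add: ins_nth_def)
  finally show ?thesis
    by (simp add: ys[symmetric]) (simp add: del_nth_def defs)
qed

lemma listset_eq_image_pick:
  assumes "\<forall>J\<in>set Js. finite J"
  shows "listset Js = map2 pick Js ` multi_indices (map card Js)"
proof (intro equalityI subsetI)
  fix "is" assume "is \<in> listset Js"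
  then have l: "length is = length Js" and m: "\<And>j. j < length Js \<Longrightarrow> is ! j \<in> Js ! j"
    by (auto simp: mem_listset list_all2_conv_all_nth)
  define ks where "ks = map2 (\<lambda>J k. card {a \<in> J. a < k}) Js is"
  have "card {a \<in> Js ! j. a < is ! j} < card (Js ! j)" if "j < length Js" for j
    using assms m[OF that] that by (intro psubset_card_mono) auto
  then have "ks \<in> multi_indices (map card Js)"
    using l by (auto simp: mem_multi_indices ks_def)
  moreover have "map2 pick Js ks = is"
    using l m by (intro nth_equalityI) (auto simp: ks_def pick_card_in_set)
  ultimately show "is \<in> map2 pick Js ` multi_indices (map card Js)"
    by blast
next
  fix "is" assume "is \<in> map2 pick Js ` multi_indices (map card Js)"
  then show "is \<in> listset Js"
    by (auto simp: mem_multi_indices mem_listset list_all2_conv_all_nth pick_in_set_le)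
qed

lemma pick_image_strict_mono:
  fixes h :: "nat \<Rightarrow> nat"
  assumes mono: "\<And>a b. a < b \<Longrightarrow> b < m \<Longrightarrow> h a < h b" and c: "c < m"
  shows "pick (h ` {..<m}) c = h c"
proof -
  have less: "h a < h b \<longleftrightarrow> a < b" if "a < m" "b < m" for a b
    using mono that by (metis less_asym linorder_neqE_nat)
  have "{a \<in> h ` {..<m}. a < h c} = h ` {..<c}"
    using less c by auto
  moreover have "inj_on h {..<c}"
    using mono c by (intro linorder_inj_onI) (auto, metis less_trans nat_neq_iff)
  ultimately have "card {a \<in> h ` {..<m}. a < h c} = c"
    by (simp add: card_image)
  then show ?thesis
    using pick_card_in_set[of "h c" "h ` {..<m}"] c by auto
qed

text \<open>If the column numbers of a subtensor are ordered in the same way as those of the tensor, as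
  for the lexicographic and the reverse lexicographic order, then \<open>C\<^sub>i(I\<^sub>i,:)\<close> is the unfolding of the
  subtensor. For other numberings this holds up to a permutation of the columns.\<close>

lemma unfolding_subtensor:
  fixes T :: "'a tensor" and \<beta> :: column_numbering
  assumes \<beta>: "is_column_numbering \<beta>" and i: "i < length (dims T)"
    and len: "length Is = length (dims T)"
    and sub: "\<And>j. j < length (dims T) \<Longrightarrow> Is ! j \<subseteq> {..<dims T ! j}"
    and mono: "\<And>js ks. js \<in> multi_indices (map card (del_nth i Is)) \<Longrightarrow>
        ks \<in> multi_indices (map card (del_nth i Is)) \<Longrightarrow>
        \<beta> i (map card (del_nth i Is)) js < \<beta> i (map card (del_nth i Is)) ks \<Longrightarrow>
        \<beta> i (del_nth i (dims T)) (map2 pick (del_nth i Is) js)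
          < \<beta> i (del_nth i (dims T)) (map2 pick (del_nth i Is) ks)"
  shows "submatrix (submatrix (unfolding_mat \<beta> i T) UNIV (column_set \<beta> i T Is)) (Is ! i) UNIV
     = unfolding_mat \<beta> i (subtensor T Is)"
proof -
  define Js where "Js = del_nth i Is"
  define es where "es = del_nth i (dims T)"
  define fs where "fs = map card Js"
  define S where "S = column_set \<beta> i T Is"
  define e where "e = inv_into (multi_indices fs) (\<beta> i fs)"
  define h where "h c = \<beta> i es (map2 pick Js (e c))" for c
  have bij: "bij_betw (\<beta> i es) (multi_indices es) {..<prod_list es}" for es
    using \<beta> by (simp add: is_column_numbering_def)
  have e: "bij_betw e {..<prod_list fs} (multi_indices fs)"
    unfolding e_def by (rule bij_betw_inv_into[OF bij])
  have \<beta>e: "\<beta> i fs (e c) = c" if "c < prod_list fs" for c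
    using that bij[of fs] unfolding e_def bij_betw_def by (intro f_inv_into_f) auto
  have e_mem: "e c \<in> multi_indices fs" if "c < prod_list fs" for c
    using that e by (auto simp: bij_betw_def)
  have lenJ: "length Js = length (dims T) - 1" and lenes: "length es = length (dims T) - 1"
    using i len by (simp_all add: Js_def es_def)
  have subJ: "Js ! j \<subseteq> {..<es ! j}" if "j < length Js" for j
    using that sub[of j] sub[of "Suc j"] i len lenJ by (auto simp: Js_def es_def nth_del_nth)
  have finJ: "\<forall>J\<in>set Js. finite J"
    by (metis subJ finite_lessThan finite_subset in_set_conv_nth)
  have lJ: "listset Js = map2 pick Js ` multi_indices fs"
    unfolding fs_def by (rule listset_eq_image_pick[OF finJ])
  have lJ_sub: "listset Js \<subseteq> multi_indices es"
    using subJ lenJ lenes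
    by (auto simp: mem_multi_indices mem_listset list_all2_conv_all_nth) blast
  have h_mono: "h a < h b" if "a < b" "b < prod_list fs" for a b
    using mono[of "e a" "e b"] that e_mem[of a] e_mem[of b] \<beta>e[of a] \<beta>e[of b]
    unfolding h_def Js_def es_def fs_def by auto
  have S: "S = h ` {..<prod_list fs}"
  proof -
    have "h ` {..<prod_list fs} = \<beta> i es ` map2 pick Js ` e ` {..<prod_list fs}"
      by (simp add: h_def image_image)
    also have "\<dots> = \<beta> i es ` listset Js"
      using e by (simp add: bij_betw_def lJ)
    finally show ?thesis by (simp add: S_def column_set_def es_def Js_def)
  qed
  have S_sub: "S \<subseteq> {..<prod_list es}"
    using lJ_sub bij[of es] by (auto simp: S_def column_set_def es_def Js_def bij_betw_def)
  have cardS: "card {c. c < prod_list es \<and> c \<in> S} = prod_list fs"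
  proof -
    have "{c. c < prod_list es \<and> c \<in> S} = h ` {..<prod_list fs}"
      using S_sub S by auto
    moreover have "inj_on h {..<prod_list fs}"
      using h_mono by (intro linorder_inj_onI) (auto, metis nat_neq_iff)
    ultimately show ?thesis by (simp add: card_image)
  qed
  have dims_sub: "dims (subtensor T Is) = map card Is"
  proof -
    have "{k. k < dims T ! j \<and> k \<in> Is ! j} = Is ! j" if "j < length (dims T)" for j
      using sub[OF that] by auto
    then show ?thesis
      using len by (intro nth_equalityI) (auto simp: subtensor_def)
  qed
  have fs_eq: "del_nth i (map card Is) = fs"
    by (simp add: fs_def Js_def del_nth_def take_map drop_map)
  have Ii: "{k. k < dims T ! i \<and> k \<in> Is ! i} = Is ! i"
    using sub[OF i] by auto
  show ?thesis
  proof (subst submatrix_split[symmetric], rule eq_matI)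
    fix k c
    assume "k < dim_row (unfolding_mat \<beta> i (subtensor T Is))"
      "c < dim_col (unfolding_mat \<beta> i (subtensor T Is))"
    then have k: "k < card (Is ! i)" and c: "c < prod_list fs"
      using i len by (simp_all add: unfolding_mat_def Let_def dims_sub fs_eq)
    have pk: "pick (Is ! i) k < dims T ! i"
      using pick_in_set_le[OF k] sub[OF i] by auto
    have hc: "pick S c = h c"
      unfolding S by (rule pick_image_strict_mono[OF h_mono c]) auto
    have mem: "map2 pick Js (e c) \<in> multi_indices es"
      using lJ lJ_sub e_mem[OF c] by auto
    have hlt: "h c < prod_list es"
      using S S_sub c by auto
    have inv: "inv_into (multi_indices es) (\<beta> i es) (h c) = map2 pick Js (e c)"
      using mem bij[of es] unfolding h_def bij_betw_def by (auto intro: inv_into_f_f)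
    have "submatrix (unfolding_mat \<beta> i T) (Is ! i) S $$ (k, c)
        = unfolding_mat \<beta> i T $$ (pick (Is ! i) k, h c)"
      using k c cardS Ii hc
      by (subst submatrix_index) (auto simp: unfolding_mat_def Let_def es_def)
    also have "\<dots> = entry T (ins_nth i (pick (Is ! i) k) (map2 pick Js (e c)))"
      using pk hlt inv by (simp add: unfolding_mat_def Let_def es_def)
    also have "\<dots> = entry T (map2 pick Is (ins_nth i k (e c)))"
    proof -
      have "length (e c) = length Is - 1"
        using e_mem[OF c] i len lenJ by (simp add: mem_multi_indices fs_def)
      then show ?thesis
        using i len by (simp add: map2_ins_nth Js_def)
    qed
    also have "\<dots> = entry (subtensor T Is) (ins_nth i k (e c))"
    proof -
      have "ins_nth i k (e c) \<in> multi_indices (map card Is)"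
        using e_mem[OF c] k i len by (intro multi_indices_ins_nth) (auto simp: fs_eq)
      then show ?thesis
        using dims_sub by (simp add: subtensor_def)
    qed
    also have "\<dots> = unfolding_mat \<beta> i (subtensor T Is) $$ (k, c)"
      using k c i len by (simp add: unfolding_mat_def Let_def dims_sub fs_eq e_def)
    finally show "submatrix (unfolding_mat \<beta> i T) (Is ! i) (column_set \<beta> i T Is) $$ (k, c)
        = unfolding_mat \<beta> i (subtensor T Is) $$ (k, c)"
      by (simp add: S_def)
  next
    show "dim_row (submatrix (unfolding_mat \<beta> i T) (Is ! i) (column_set \<beta> i T Is))
        = dim_row (unfolding_mat \<beta> i (subtensor T Is))"
      using i len Ii by (simp add: dim_submatrix unfolding_mat_def Let_def dims_sub)
    show "dim_col (submatrix (unfolding_mat \<beta> i T) (Is ! i) (column_set \<beta> i T Is))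
        = dim_col (unfolding_mat \<beta> i (subtensor T Is))"
      using cardS by (simp add: dim_submatrix unfolding_mat_def Let_def dims_sub fs_eq es_def S_def)
  qed
qed

end

theory Submission
  imports Defs
begin

text \<open>Write \<open>M\<^sub>i\<close> for the mode-\<open>i\<close> unfolding of \<open>T\<close>. Selecting rows and columns is multiplication by
  \<open>0\<close>-\<open>1\<close> matrices: \<open>C\<^sub>i = M\<^sub>i S\<^sub>i\<close> and \<open>U\<^sub>i = P\<^sub>i M\<^sub>i S\<^sub>i\<close>. The theorem follows from three facts.

  First, a matrix fact. If \<open>P M S\<close> has the same rank as \<open>M\<close>, then neither multiplication loses
  information: \<open>M = Q (P M)\<close> and \<open>M = (M S) X\<close> for suitable \<open>Q\<close> and \<open>X\<close>. Hence
  \<open>M S G P M = Q (P M S G P M S) X = Q (P M S) X = M\<close> for every generalized inverse \<open>G\<close> of \<open>P M S\<close>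
  (lemma \<open>cross_decomposition\<close>). Both cancellations come from a rank factorization, since a matrix of
  full column rank has a left inverse.

  Second, mode products in different modes commute and mode products in one mode compose, and the
  subtensor \<open>R\<close> is the mode product of \<open>T\<close> with all the row selections \<open>P\<^sub>i\<close>. Therefore multiplying \<open>R\<close>
  by matrices \<open>Y\<^sub>i\<close> multiplies \<open>T\<close> by \<open>Y\<^sub>i P\<^sub>i\<close>, and gives back \<open>T\<close> as soon as \<open>Y\<^sub>i P\<^sub>i M\<^sub>i = M\<^sub>i\<close> for
  all \<open>i\<close>. Under (i) the first fact says that \<open>Y\<^sub>i = C\<^sub>i G\<^sub>i\<close> has this property, whence (iii). Under (v),
  some left inverse \<open>Y\<^sub>i\<close> of \<open>P\<^sub>i\<close> on the column space of \<open>M\<^sub>i\<close> has it.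

  Third, a mode product, in whatever mode, cannot increase the rank of any unfolding: in another mode
  it acts on the columns of the unfolding, replacing them by linear combinations of columns. So
  whenever \<open>T\<close> is recovered from \<open>R\<close> by some mode products at all, as it is under (ii) and (v), the
  ranks of the unfoldings of \<open>R\<close> are at least those of \<open>T\<close>; since \<open>U\<^sub>i\<close> has the same columns as the
  unfolding of \<open>R\<close>, up to order, this is (i). That coincidence of columns also gives the equivalence of
  (i) and (iv).

  Of the other implications, (iii) gives (ii) because every matrix has a generalized inverse, and (i)
  gives (v) because the rank of \<open>P\<^sub>i M\<^sub>i\<close> lies between those of \<open>U\<^sub>i\<close> and \<open>M\<^sub>i\<close>. For the same reason (i)
  makes \<open>C\<^sub>i\<close> span the column space of \<open>M\<^sub>i\<close>, so that \<open>C\<^sub>i H\<^sub>i\<close>, which fixes the columns of \<open>C\<^sub>i\<close>, fixes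
  \<open>M\<^sub>i\<close>, and multiplying \<open>T\<close> by all the \<open>C\<^sub>i H\<^sub>i\<close> leaves it unchanged.\<close>

section \<open>Rank factorizations and generalized inverses\<close>

lemma mat_rank_mult_le_left:
  fixes A :: "'a::field mat"
  assumes A: "A \<in> carrier_mat m k" and B: "B \<in> carrier_mat k l"
  shows "mat_rank (A * B) \<le> mat_rank A"
proof -
  interpret vec_space "TYPE('a)" m .
  have AB: "A * B \<in> carrier_mat m l" using A B by simp
  have cA: "set (cols A) \<subseteq> carrier_vec m" and cAB: "set (cols (A * B)) \<subseteq> carrier_vec m"
    using A AB cols_dim by blast+
  have "set (cols (A * B)) \<subseteq> span (set (cols A))"
  proof
    fix v assume "v \<in> set (cols (A * B))"
    then obtain j where j: "j < l" "v = col (A * B) j"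
      using AB by (metis cols_length cols_nth in_set_conv_nth carrier_matD(2))
    then have "v = A *\<^sub>v col B j" using A B by (metis carrier_matD(2) col_mult2)
    then show "v \<in> span (set (cols A))"
      using A B j col_space_eq[OF A] unfolding col_space_def by (auto intro!: bexI[of _ "col B j"])
  qed
  then have sub: "span (set (cols (A * B))) \<subseteq> span (set (cols A))"
    by (metis cA cAB span_is_submodule span_is_subset)
  have "VectorSpace.subspace class_ring (span (set (cols (A * B)))) (vs (span (set (cols A))))"
    using nested_subspaces[OF span_is_subspace[OF cA] span_is_subspace[OF cAB] sub] .
  then have "rank (A * B) \<le> rank A"
    unfolding rank_def
    using vectorspace.subspace_dim[OF subspace_is_vs[OF span_is_subspace[OF cA]]]
      fin_dim_span_cols[OF A] fin_dim_span_cols[OF AB] by auto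
  then show ?thesis using A AB by simp
qed

text \<open>The columns of the first factor are a maximal independent set of columns of \<open>A\<close>; the second factor
  holds the coordinates of the columns of \<open>A\<close>. A rank defined by
  columns is thereby described by an inner dimension, which transposition preserves.\<close>

lemma rank_factorization:
  fixes A :: "'a::field mat"
  assumes A: "A \<in> carrier_mat m l"
  obtains B C where "B \<in> carrier_mat m (mat_rank A)" "C \<in> carrier_mat (mat_rank A) l" "A = B * C"
proof -
  interpret vec_space "TYPE('a)" m .
  have cA: "set (cols A) \<subseteq> carrier_vec m" using A cols_dim by blast
  have "lin_indpt {}" by (rule finite_lin_indpt2) auto
  then obtain S where S: "maximal S (\<lambda>T. T \<subseteq> set (cols A) \<and> lin_indpt T)"
    using maximal_exists_superset[of "set (cols A)" "\<lambda>T. T \<subseteq> set (cols A) \<and> lin_indpt T" "{}"]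
    by auto
  then have SA: "S \<subseteq> set (cols A)" and li: "lin_indpt S" by (auto simp: maximal_def)
  have Sm: "S \<subseteq> carrier_vec m" using SA cA by blast
  obtain ws where ws: "set ws = S" "distinct ws"
    using finite_distinct_list SA by (meson List.finite_set finite_subset)
  have r: "mat_rank A = length ws"
    using rank_card_indpt[OF A S] A ws distinct_card by fastforce
  define B where "B = mat_of_cols m ws"
  have B: "B \<in> carrier_mat m (length ws)" and cB: "cols B = ws"
    using ws Sm by (auto simp: B_def)
  have "\<exists>x \<in> carrier_vec (length ws). col A j = B *\<^sub>v x" if j: "j < l" for j
  proof -
    have mem: "col A j \<in> set (cols A)" using A j by (auto simp: cols_def)
    have "col A j \<in> span S"
    proof (rule ccontr)
      assume n: "col A j \<notin> span S"
      have nS: "col A j \<notin> S" using n Sm span_mem by blast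
      have "lin_indpt (S \<union> {col A j})"
        using lin_dep_iff_in_span[OF _ li _ nS] Sm mem cA n by auto
      with S SA mem have "S = S \<union> {col A j}" unfolding maximal_def by blast
      with nS show False by blast
    qed
    then have "col A j \<in> col_space B" by (simp add: col_space_def cB ws(1))
    then obtain x where "x \<in> carrier_vec (dim_col B)" "B *\<^sub>v x = col A j"
      unfolding col_space_eq[OF B] by blast
    then show ?thesis using B by (intro bexI[of _ x]) auto
  qed
  then obtain x where x: "\<And>j. j < l \<Longrightarrow> x j \<in> carrier_vec (length ws) \<and> col A j = B *\<^sub>v x j" by metis
  define C where "C = mat_of_cols (length ws) (map x [0..<l])"
  have C: "C \<in> carrier_mat (length ws) l" by (simp add: C_def carrier_matI)
  have "A = B * C"
  proof (rule eq_matI)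
    fix i j assume "i < dim_row (B * C)" "j < dim_col (B * C)"
    then have ij: "i < m" "j < l" using B C by auto
    have "A $$ (i, j) = col A j $ i" using A ij by simp
    also have "\<dots> = (B *\<^sub>v x j) $ i" using x ij by simp
    also have "\<dots> = (B * C) $$ (i, j)" using B C ij x by (simp add: C_def)
    finally show "A $$ (i, j) = (B * C) $$ (i, j)" .
  qed (use A B C in auto)
  then show thesis using that B C r by metis
qed

lemma mat_rank_le_factorization:
  fixes B :: "'a::field mat"
  assumes B: "B \<in> carrier_mat m k" and C: "C \<in> carrier_mat k l"
  shows "mat_rank (B * C) \<le> k"
  using mat_rank_mult_le_left[OF B C] vec_space.rank_le_nc[OF B] B by simp

lemma mat_rank_transpose:
  fixes A :: "'a::field mat"
  shows "mat_rank (transpose_mat A) = mat_rank A"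
proof -
  have le: "mat_rank (transpose_mat A) \<le> mat_rank A" for A :: "'a mat"
  proof -
    obtain B C where B: "B \<in> carrier_mat (dim_row A) (mat_rank A)"
      and C: "C \<in> carrier_mat (mat_rank A) (dim_col A)" and A: "A = B * C"
      using rank_factorization[OF carrier_matI[OF refl refl]] .
    have "transpose_mat A = transpose_mat C * transpose_mat B"
      by (subst A) (rule transpose_mult[OF B C])
    then show ?thesis
      using mat_rank_le_factorization[of "transpose_mat C" "dim_col A" "mat_rank A" "transpose_mat B" "dim_row A"]
        B C by simp
  qed
  show ?thesis using le[of A] le[of "transpose_mat A"] by simp
qed

lemma mat_rank_mult_le_right:
  fixes A :: "'a::field mat"
  assumes A: "A \<in> carrier_mat m k" and B: "B \<in> carrier_mat k l"
  shows "mat_rank (A * B) \<le> mat_rank B"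
proof -
  have "mat_rank (transpose_mat B * transpose_mat A) \<le> mat_rank (transpose_mat B)"
    using A B by (intro mat_rank_mult_le_left) auto
  then show ?thesis
    unfolding transpose_mult[OF A B, symmetric] mat_rank_transpose .
qed

text \<open>Row reduction gives \<open>P A = E\<close> with \<open>P\<close> invertible and \<open>E\<close> in reduced row echelon form. Sending the
  \<open>k\<close>-th unit vector to the unit vector at the \<open>k\<close>-th pivot, or to \<open>0\<close> if there is none, is a generalized inverse \<open>N\<close> of \<open>E\<close>, and
  \<open>N P\<close> is one of \<open>A\<close>.\<close>

lemma generalized_inverse_exists:
  fixes A :: "'a::field mat"
  shows "\<exists>G. is_generalized_inverse A G"
proof -
  define m l where "m = dim_row A" "l = dim_col A"
  note defs = this
  have A: "A \<in> carrier_mat m l" by (simp add: defs)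
  define E where "E = gauss_jordan_single A"
  note gj = gauss_jordan_single[OF A E_def[symmetric]]
  have E: "E \<in> carrier_mat m l" by (rule gj)
  obtain P Q where P: "P \<in> carrier_mat m m" "Q \<in> carrier_mat m m"
    and PQ: "Q * P = 1\<^sub>m m" "E = P * A"
    using gj(4) by blast
  obtain f where f: "pivot_fun E f l"
    using gj(3) E by (auto simp: row_echelon_form_def)
  note p = pivot_funD[OF carrier_matD(1)[OF E] f]
  define N :: "'a mat" where "N = mat l m (\<lambda>(j, i). if j = f i then 1 else 0)"
  have N: "N \<in> carrier_mat l m" by (simp add: N_def)
  \<comment> \<open>The columns of \<open>E * N\<close> are the pivot columns of \<open>E\<close>, followed by zero columns.\<close>
  have EN: "(E * N) $$ (i, k) = (if i = k \<and> f i < l then 1 else 0)" if "i < m" "k < m" for i k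
  proof -
    have "(E * N) $$ (i, k) = (\<Sum>j<l. E $$ (i, j) * (if j = f k then 1 else 0))"
      using that E N by (simp add: scalar_prod_def N_def atLeast0LessThan)
    also have "\<dots> = (if f k < l then E $$ (i, f k) else 0)"
      by (auto simp: sum.delta' if_distrib cong: if_cong)
    also have "\<dots> = (if i = k \<and> f i < l then 1 else 0)"
      using p(4)[of k] p(5)[of k i] that by auto
    finally show ?thesis .
  qed
  have ENE: "E * N * E = E"
  proof (rule eq_matI)
    fix i j assume "i < dim_row E" "j < dim_col E"
    then have ij: "i < m" "j < l" using E by auto
    have "(E * N * E) $$ (i, j) = (\<Sum>k<m. (E * N) $$ (i, k) * E $$ (k, j))"
      using ij E N by (simp add: scalar_prod_def atLeast0LessThan del: assoc_mult_mat)
    also have "\<dots> = (\<Sum>k<m. if k = i then (if f i < l then E $$ (i, j) else 0) else 0)"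
      using ij by (intro sum.cong) (auto simp: EN)
    also have "\<dots> = (if f i < l then E $$ (i, j) else 0)"
      using ij by (simp add: sum.delta)
    also have "\<dots> = E $$ (i, j)"
      using p(1)[of i] p(2)[of i j] ij by auto
    finally show "(E * N * E) $$ (i, j) = E $$ (i, j)" .
  qed (use E N in auto)
  have QE: "Q * E = A"
    unfolding PQ(2) using assoc_mult_mat[OF P(2,1) A] PQ(1) A by simp
  have NP: "N * P \<in> carrier_mat l m" using N P by simp
  have "A * (N * P) * A = A * (N * E)"
    unfolding PQ(2) using assoc_mult_mat[OF A NP A] assoc_mult_mat[OF N P(1) A] by metis
  also have "\<dots> = Q * (E * N * E)"
    using assoc_mult_mat[OF P(2) E, of "N * E" l] assoc_mult_mat[OF E N E] N E by (simp add: QE)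
  also have "\<dots> = A"
    unfolding ENE by (rule QE)
  finally have "is_generalized_inverse A (N * P)"
    using N P by (simp add: is_generalized_inverse_def defs)
  then show ?thesis by blast
qed

text \<open>If \<open>G\<close> is a generalized inverse of \<open>D\<close>, then \<open>E = G D\<close> satisfies \<open>D E = D\<close>, so that \<open>E\<close> has rank at
  least \<open>k\<close> and is invertible. As \<open>E\<close> is also idempotent, it is the identity and \<open>G\<close> is the left
  inverse.\<close>

lemma full_column_rank_imp_left_inverse:
  fixes D :: "'a::field mat"
  assumes D: "D \<in> carrier_mat m k" and r: "k \<le> mat_rank D"
  obtains L where "L \<in> carrier_mat k m" "L * D = 1\<^sub>m k"
proof -
  obtain G where G: "G \<in> carrier_mat k m" and DGD: "D * G * D = D"
    using generalized_inverse_exists[of D] D by (auto simp: is_generalized_inverse_def)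
  define E where "E = G * D"
  have E: "E \<in> carrier_mat k k" using D G by (simp add: E_def)
  have DE: "D * E = D" using DGD D G by (simp add: E_def assoc_mult_mat[of D m k G m D k])
  have EE: "E * E = E"
    using DE D G E by (simp add: E_def assoc_mult_mat[of G k m D k _ k])
  have "k \<le> mat_rank E"
    using mat_rank_mult_le_right[OF D E] DE r by simp
  moreover have "mat_rank E \<le> k"
    using vec_space.rank_le_nc[OF E] E by simp
  ultimately have "det E \<noteq> 0"
    using vec_space.det_rank_iff[OF E] E by simp
  then obtain F where F: "F \<in> carrier_mat k k" "F * E = 1\<^sub>m k"
    using det_non_zero_imp_unit[OF E, of undefined] by (auto simp: Units_def ring_mat_def)
  \<comment> \<open>An invertible idempotent is the identity.\<close>
  have "E = F * E * E" using F E by simp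
  also have "\<dots> = 1\<^sub>m k" using F EE assoc_mult_mat[OF F(1) E E] by simp
  finally show thesis using that G by (simp add: E_def)
qed

text \<open>If multiplication by \<open>P\<close> preserves the rank of \<open>M\<close>, then \<open>P\<close> is injective on the column space of
  \<open>M\<close>: with a rank factorization \<open>M = B C\<close>, the matrix \<open>P B\<close> has full column rank, and a left inverse
  \<open>L\<close> of it yields \<open>B L\<close> as the matrix that undoes \<open>P\<close>.\<close>

lemma left_cancel_of_rank:
  fixes M :: "'a::field mat"
  assumes M: "M \<in> carrier_mat m l" and P: "P \<in> carrier_mat p m"
    and r: "mat_rank (P * M) = mat_rank M"
  obtains Q where "Q \<in> carrier_mat m p" "Q * (P * M) = M"
proof -
  define k where "k = mat_rank M"
  obtain B C where B: "B \<in> carrier_mat m k" and C: "C \<in> carrier_mat k l" and M_eq: "M = B * C"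
    using rank_factorization[OF M] unfolding k_def by blast
  have PM: "P * M = P * B * C"
    using P B C by (simp add: M_eq assoc_mult_mat[of P p m B k C l])
  have PB: "P * B \<in> carrier_mat p k" using P B by simp
  have "k \<le> mat_rank (P * B)"
    using mat_rank_mult_le_left[OF PB C] r by (simp add: PM k_def)
  then obtain L where L: "L \<in> carrier_mat k p" "L * (P * B) = 1\<^sub>m k"
    using full_column_rank_imp_left_inverse[OF PB] by blast
  have "B * L * (P * M) = B * (L * (P * B) * C)"
    unfolding PM using B C L(1) PB
    by (simp add: assoc_mult_mat[of B m k L p _ l] assoc_mult_mat[of L k p "P * B" k C l])
  also have "\<dots> = M" using L C by (simp add: M_eq)
  finally show thesis using that[of "B * L"] B L(1) by simp
qed

text \<open>The transpose of the previous lemma: if \<open>M S\<close> has the rank of \<open>M\<close>, its columns still span the column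
  space of \<open>M\<close>.\<close>

lemma right_cancel_of_rank:
  fixes M :: "'a::field mat"
  assumes M: "M \<in> carrier_mat m l" and S: "S \<in> carrier_mat l s"
    and r: "mat_rank (M * S) = mat_rank M"
  obtains X where "X \<in> carrier_mat s l" "M * S * X = M"
proof -
  have t: "transpose_mat (M * S) = transpose_mat S * transpose_mat M"
    using M S by (rule transpose_mult)
  have "mat_rank (transpose_mat S * transpose_mat M) = mat_rank (transpose_mat M)"
    using r unfolding t[symmetric] mat_rank_transpose .
  then obtain Q where Q: "Q \<in> carrier_mat l s"
      "Q * (transpose_mat S * transpose_mat M) = transpose_mat M"
    using left_cancel_of_rank[of "transpose_mat M" l m "transpose_mat S" s] M S
    by (metis transpose_carrier_mat)
  have "M * S * transpose_mat Q = transpose_mat (Q * transpose_mat (M * S))"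
    using M S Q by (subst transpose_mult[of Q l s _ m]) auto
  also have "\<dots> = M" using Q by (simp add: t)
  finally show thesis using that[of "transpose_mat Q"] Q by simp
qed

text \<open>The matrix case of the theorem. The block \<open>P M S\<close>, having the rank of \<open>M\<close>, determines \<open>M\<close> from the
  columns \<open>M S\<close> and the rows \<open>P M\<close>, whichever generalized inverse is taken.\<close>

lemma cross_decomposition:
  fixes M :: "'a::field mat"
  assumes M: "M \<in> carrier_mat m l" and P: "P \<in> carrier_mat p m" and S: "S \<in> carrier_mat l s"
    and r: "mat_rank (P * (M * S)) = mat_rank M"
    and G: "is_generalized_inverse (P * (M * S)) G"
  shows "M * S * G * P * M = M"
proof -
  have MS: "M * S \<in> carrier_mat m s" and PM: "P * M \<in> carrier_mat p l" using M P S by auto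
  define U where "U = P * (M * S)"
  have U_eq: "U = P * M * S" unfolding U_def by (rule assoc_mult_mat[OF P M S, symmetric])
  have U: "U \<in> carrier_mat p s" using P MS by (simp add: U_def)
  have Gc: "G \<in> carrier_mat s p" and UGU: "U * G * U = U"
    using G U unfolding is_generalized_inverse_def U_def[symmetric] by auto
  have "mat_rank (M * S) = mat_rank M"
    using mat_rank_mult_le_left[OF M S] mat_rank_mult_le_right[OF P MS] r by simp
  then obtain X where X: "X \<in> carrier_mat s l" "M * S * X = M"
    using right_cancel_of_rank[OF M S] by blast
  have "mat_rank (P * M) = mat_rank M"
    using mat_rank_mult_le_left[OF PM S] mat_rank_mult_le_right[OF P M] r
    by (simp add: U_eq[symmetric] U_def)
  then obtain Q where Q: "Q \<in> carrier_mat m p" "Q * (P * M) = M"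
    using left_cancel_of_rank[OF M P] by blast
  have QU: "Q * U = M * S"
    unfolding U_eq using assoc_mult_mat[OF Q(1) PM S] Q(2) by simp
  have UX: "U * X = P * M"
    unfolding U_def using assoc_mult_mat[OF P MS X(1)] X(2) by simp
  have UG: "U * G \<in> carrier_mat p p" and UXc: "U * X \<in> carrier_mat p l" using U Gc X by auto
  have "M * S * G * P * M = Q * U * G * (U * X)"
    unfolding QU UX by (rule assoc_mult_mat[OF mult_carrier_mat[OF MS Gc] P M])
  also have "\<dots> = Q * (U * G * U * X)"
    by (simp only: assoc_mult_mat[OF Q(1) U Gc] assoc_mult_mat[OF Q(1) UG UXc]
        assoc_mult_mat[OF UG U X(1)])
  also have "\<dots> = M"
    unfolding UGU UX by (rule Q(2))
  finally show ?thesis .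
qed

section \<open>The algebra of mode products\<close>

lemma column_number_less:
  assumes "is_column_numbering \<beta>" "js \<in> multi_indices es"
  shows "\<beta> i es js < prod_list es"
    and "inv_into (multi_indices es) (\<beta> i es) (\<beta> i es js) = js"
  using assms by (auto simp: is_column_numbering_def bij_betw_def inv_into_f_f)

lemma column_index:
  assumes "is_column_numbering \<beta>" "c < prod_list es"
  shows "inv_into (multi_indices es) (\<beta> i es) c \<in> multi_indices es"
    and "\<beta> i es (inv_into (multi_indices es) (\<beta> i es) c) = c"
  using assms unfolding is_column_numbering_def bij_betw_def
  by (auto intro!: inv_into_into f_inv_into_f)

lemma unfolding_mat_carrier:
  "unfolding_mat \<beta> i T \<in> carrier_mat (dims T ! i) (prod_list (del_nth i (dims T)))"
  by (simp add: unfolding_mat_def Let_def)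

lemma unfolding_mat_index:
  assumes \<beta>: "is_column_numbering \<beta>" and i: "i < length (dims T)"
    and "is": "is \<in> multi_indices (dims T)"
  shows "unfolding_mat \<beta> i T $$ (is ! i, \<beta> i (del_nth i (dims T)) (del_nth i is)) = entry T is"
proof -
  have "is ! i < dims T ! i" "i < length is" using "is" i by (auto simp: mem_multi_indices)
  then show ?thesis
    using column_number_less[OF \<beta> multi_indices_del_nth[OF i "is"], of i]
    by (simp add: unfolding_mat_def Let_def)
qed

lemma multi_indices_update:
  assumes "is \<in> multi_indices (ds[i := e])" "k < ds ! i"
  shows "is[i := k] \<in> multi_indices ds"
  unfolding mem_multi_indices
proof (intro conjI allI impI)
  show "length (is[i := k]) = length ds" using assms(1) by (simp add: mem_multi_indices)
  fix j assume j: "j < length ds"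
  show "is[i := k] ! j < ds ! j"
    using assms j by (cases "j = i") (auto simp: mem_multi_indices)
qed

text \<open>The entries of a mode product are described by the formula that makes no reference to a numbering of
  columns; the remaining facts on mode products rest on it or on \<open>mode_product_unique\<close>.\<close>

lemma entry_mode_product:
  assumes \<beta>: "is_column_numbering \<beta>" and i: "i < length (dims S)"
    and "is": "is \<in> multi_indices ((dims S)[i := dim_row Y])"
  shows "entry (mode_product \<beta> i S Y) is = (\<Sum>k<dims S ! i. row Y (is ! i) $ k * entry S (is[i := k]))"
proof -
  define es where "es = del_nth i (dims S)"
  define c where "c = \<beta> i es (del_nth i is)"
  have li: "i < length is" and row: "is ! i < dim_row Y"
    using "is" i by (auto simp: mem_multi_indices dest: spec[of _ i])
  have js: "del_nth i is \<in> multi_indices es"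
    using multi_indices_del_nth[OF _ "is", of i] i by (simp add: es_def)
  have c: "c < prod_list es" unfolding c_def by (rule column_number_less[OF \<beta> js])
  have unf: "unfolding_mat \<beta> i S $$ (k, c) = entry S (is[i := k])" if k: "k < dims S ! i" for k
  proof -
    have "is[i := k] \<in> multi_indices (dims S)"
      using multi_indices_update[OF "is" k] .
    from unfolding_mat_index[OF \<beta> i this] show ?thesis using li by (simp add: c_def es_def)
  qed
  have "entry (mode_product \<beta> i S Y) is = (Y * unfolding_mat \<beta> i S) $$ (is ! i, c)"
    using "is" by (simp add: mode_product_def c_def es_def)
  also have "\<dots> = (\<Sum>k<dims S ! i. row Y (is ! i) $ k * unfolding_mat \<beta> i S $$ (k, c))"
    using row c unfolding_mat_carrier[of \<beta> i S]
    by (simp add: scalar_prod_def es_def atLeast0LessThan)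
  finally show ?thesis using unf by simp
qed

text \<open>Both sides are the same double sum over the indices of modes \<open>i\<close> and \<open>j\<close>, summed in different order.\<close>

lemma mode_product_commute:
  assumes \<beta>: "is_column_numbering \<beta>" and i: "i < length (dims S)" and j: "j < length (dims S)"
    and ij: "i \<noteq> j"
  shows "mode_product \<beta> i (mode_product \<beta> j S B) A = mode_product \<beta> j (mode_product \<beta> i S A) B"
    (is "?L = ?R")
proof (rule tensor_eqI)
  show "dims ?L = dims ?R" using ij by (simp add: dims_mode_product list_update_swap)
next
  fix "is" assume "is \<in> multi_indices (dims ?R)"
  then have mem: "is \<in> multi_indices ((dims S)[i := dim_row A, j := dim_row B])"
    by (simp add: dims_mode_product)
  then have mem': "is \<in> multi_indices ((dims S)[j := dim_row B, i := dim_row A])"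
    using ij by (simp add: list_update_swap)
  have mi: "is[i := k] \<in> multi_indices ((dims S)[j := dim_row B])" if "k < dims S ! i" for k
    using multi_indices_update[OF mem'] that ij by simp
  have mj: "is[j := k] \<in> multi_indices ((dims S)[i := dim_row A])" if "k < dims S ! j" for k
    using multi_indices_update[OF mem] that ij by simp
  have "entry ?L is = (\<Sum>k<dims S ! i. \<Sum>l<dims S ! j.
      row A (is ! i) $ k * (row B (is ! j) $ l * entry S (is[i := k, j := l])))"
    using \<beta> i j ij mem' mi by (simp add: entry_mode_product dims_mode_product sum_distrib_left)
  also have "\<dots> = (\<Sum>l<dims S ! j. \<Sum>k<dims S ! i.
      row B (is ! j) $ l * (row A (is ! i) $ k * entry S (is[j := l, i := k])))"
    using ij by (subst sum.swap) (simp add: list_update_swap[of i j] mult.left_commute)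
  also have "\<dots> = entry ?R is"
    using \<beta> i j ij mem mj by (simp add: entry_mode_product dims_mode_product sum_distrib_left)
  finally show "entry ?L is = entry ?R is" .
qed

lemma mode_product_mode_product:
  assumes \<beta>: "is_column_numbering \<beta>" and i: "i < length (dims S)"
    and P: "P \<in> carrier_mat p (dims S ! i)" and Y: "Y \<in> carrier_mat m p"
  shows "mode_product \<beta> i (mode_product \<beta> i S P) Y = mode_product \<beta> i S (Y * P)"
proof (rule mode_product_unique[OF \<beta> i])
  show "dims (mode_product \<beta> i (mode_product \<beta> i S P) Y) = (dims S)[i := dim_row (Y * P)]"
    by (simp add: dims_mode_product)
  show "unfolding_mat \<beta> i (mode_product \<beta> i (mode_product \<beta> i S P) Y) = Y * P * unfolding_mat \<beta> i S"
    using \<beta> i assoc_mult_mat[OF Y P unfolding_mat_carrier, of \<beta>]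
    by (simp add: unfolding_mode_product dims_mode_product del: assoc_mult_mat)
qed

lemma mode_product_ident:
  assumes "is_column_numbering \<beta>" "i < length (dims T)" "dim_row Y = dims T ! i"
    and "Y * unfolding_mat \<beta> i T = unfolding_mat \<beta> i T"
  shows "mode_product \<beta> i T Y = T"
  using mode_product_unique[of \<beta> i T T Y] assms by simp

lemma length_dims_fold_mode_product [simp]:
  "length (dims (fold (\<lambda>i S. mode_product \<beta> i S (Y i)) ms S)) = length (dims S)"
  by (induction ms arbitrary: S) (simp_all add: dims_mode_product)

lemma dims_fold_mode_product_other:
  "j \<notin> set ms \<Longrightarrow> dims (fold (\<lambda>i S. mode_product \<beta> i S (Y i)) ms S) ! j = dims S ! j"
  by (induction ms arbitrary: S) (simp_all add: dims_mode_product)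

text \<open>This is what lets two sequences of multiplications be merged mode by mode.\<close>

lemma fold_mode_product_commute:
  assumes \<beta>: "is_column_numbering \<beta>" and "j < length (dims S)" "j \<notin> set ms"
    and "\<forall>i\<in>set ms. i < length (dims S)"
  shows "fold (\<lambda>i S. mode_product \<beta> i S (Y i)) ms (mode_product \<beta> j S A)
     = mode_product \<beta> j (fold (\<lambda>i S. mode_product \<beta> i S (Y i)) ms S) A"
  using assms(2-)
proof (induction ms arbitrary: S)
  case (Cons i ms)
  then have "mode_product \<beta> i (mode_product \<beta> j S A) (Y i) = mode_product \<beta> j (mode_product \<beta> i S (Y i)) A"
    by (intro mode_product_commute[OF \<beta>]) auto
  then show ?case using Cons.prems by (simp add: Cons.IH dims_mode_product)
qed simp

text \<open>Induction on the number of modes processed so far: the last factor of the inner product is moved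
  outwards past the outer factors in the earlier modes, where it meets the outer factor of its own
  mode.\<close>

lemma multi_mode_product_multi_mode_product:
  assumes \<beta>: "is_column_numbering \<beta>"
    and P: "\<And>i. i < length (dims T) \<Longrightarrow> P i \<in> carrier_mat (p i) (dims T ! i)"
    and Y: "\<And>i. i < length (dims T) \<Longrightarrow> Y i \<in> carrier_mat (m i) (p i)"
  shows "multi_mode_product \<beta> (multi_mode_product \<beta> T P) Y = multi_mode_product \<beta> T (\<lambda>i. Y i * P i)"
proof -
  let ?F = "\<lambda>Y k. fold (\<lambda>i S. mode_product \<beta> i S (Y i)) [0..<k]"
  have "?F Y k (?F P k T) = ?F (\<lambda>i. Y i * P i) k T" if "k \<le> length (dims T)" for k
    using that
  proof (induction k)
    case (Suc k)
    let ?S = "?F (\<lambda>i. Y i * P i) k T"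
    have k: "k < length (dims ?S)" using Suc.prems by simp
    have "?F Y (Suc k) (?F P (Suc k) T)
        = mode_product \<beta> k (?F Y k (mode_product \<beta> k (?F P k T) (P k))) (Y k)"
      by simp
    also have "?F Y k (mode_product \<beta> k (?F P k T) (P k)) = mode_product \<beta> k (?F Y k (?F P k T)) (P k)"
      using Suc.prems by (intro fold_mode_product_commute[OF \<beta>]) auto
    also have "?F Y k (?F P k T) = ?S" using Suc by simp
    also have "mode_product \<beta> k (mode_product \<beta> k ?S (P k)) (Y k) = mode_product \<beta> k ?S (Y k * P k)"
      using Suc.prems by (intro mode_product_mode_product[OF \<beta> k _ Y])
        (simp_all add: P dims_fold_mode_product_other)
    finally show ?case by simp
  qed simp
  then show ?thesis by (simp add: multi_mode_product_def)
qed

lemma multi_mode_product_ident: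
  assumes \<beta>: "is_column_numbering \<beta>"
    and "\<And>i. i < length (dims T) \<Longrightarrow> dim_row (Y i) = dims T ! i"
    and "\<And>i. i < length (dims T) \<Longrightarrow> Y i * unfolding_mat \<beta> i T = unfolding_mat \<beta> i T"
  shows "multi_mode_product \<beta> T Y = T"
proof -
  have "fold (\<lambda>i S. mode_product \<beta> i S (Y i)) [0..<k] T = T" if "k \<le> length (dims T)" for k
    using that by (induction k) (simp_all add: mode_product_ident[OF \<beta>] assms)
  then show ?thesis by (simp add: multi_mode_product_def)
qed

section \<open>Subtensors as mode products with selection matrices\<close>

text \<open>Left multiplication by this matrix selects the rows in \<open>I\<close> of a matrix with \<open>d\<close> rows, in increasing
  order.\<close>

definition row_selector :: "nat \<Rightarrow> nat set \<Rightarrow> 'a::field mat" where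
  "row_selector d I = submatrix (1\<^sub>m d) I UNIV"

lemma row_selector_carrier: "row_selector d I \<in> carrier_mat (card {k. k < d \<and> k \<in> I}) d"
  by (rule carrier_matI) (simp_all add: row_selector_def dim_submatrix)

lemma row_selector_index:
  assumes "k < card {k. k < d \<and> k \<in> I}" "j < d"
  shows "row_selector d I $$ (k, j) = (if j = pick I k then 1 else 0)"
  using assms by (auto simp: row_selector_def submatrix_index pick_UNIV pick_le)

lemma submatrix_rows_eq_mult:
  fixes A :: "'a::field mat"
  shows "submatrix A I UNIV = row_selector (dim_row A) I * A"
proof (rule eq_matI)
  note [simp] = carrier_matD[OF row_selector_carrier]
  fix k c assume "k < dim_row (row_selector (dim_row A) I * A)" "c < dim_col (row_selector (dim_row A) I * A)"
  then have k: "k < card {k. k < dim_row A \<and> k \<in> I}" and c: "c < dim_col A"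
    by simp_all
  have "(row_selector (dim_row A) I * A) $$ (k, c)
      = (\<Sum>j<dim_row A. (if j = pick I k then 1 else 0) * A $$ (j, c))"
    using k c by (simp add: scalar_prod_def atLeast0LessThan row_selector_index)
  also have "\<dots> = A $$ (pick I k, c)"
    using pick_le[OF k] by (simp add: if_distrib[of "\<lambda>x. x * _"] sum.delta cong: if_cong)
  finally show "submatrix A I UNIV $$ (k, c) = (row_selector (dim_row A) I * A) $$ (k, c)"
    using k c by (simp add: submatrix_index pick_UNIV)
qed (simp_all add: dim_submatrix carrier_matD[OF row_selector_carrier])

lemma submatrix_cols_eq_mult:
  fixes A :: "'a::field mat"
  shows "submatrix A UNIV J = A * transpose_mat (row_selector (dim_col A) J)"
proof -
  have t: "submatrix A UNIV J = transpose_mat (submatrix (transpose_mat A) J UNIV)"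
    by (rule eq_matI) (simp_all add: dim_submatrix submatrix_index pick_UNIV pick_le)
  show ?thesis
    unfolding t submatrix_rows_eq_mult
    using transpose_mult[OF row_selector_carrier carrier_matI, of "transpose_mat A" "dim_col A" "dim_row A"]
    by simp
qed

lemma entry_mode_product_row_selector:
  assumes \<beta>: "is_column_numbering \<beta>" and i: "i < length (dims S)"
    and "is": "is \<in> multi_indices ((dims S)[i := card {k. k < dims S ! i \<and> k \<in> I}])"
  shows "entry (mode_product \<beta> i S (row_selector (dims S ! i) I)) is = entry S (is[i := pick I (is ! i)])"
proof -
  note [simp] = carrier_matD[OF row_selector_carrier]
  have k: "is ! i < card {k. k < dims S ! i \<and> k \<in> I}"
    using "is" i by (auto simp: mem_multi_indices dest: spec[of _ i])
  have "entry (mode_product \<beta> i S (row_selector (dims S ! i) I)) is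
      = (\<Sum>j<dims S ! i. (if j = pick I (is ! i) then 1 else 0) * entry S (is[i := j]))"
    using k "is" by (simp add: entry_mode_product[OF \<beta> i] row_selector_index)
  also have "\<dots> = entry S (is[i := pick I (is ! i)])"
    using pick_le[OF k] by (simp add: if_distrib[of "\<lambda>x. x * _"] sum.delta cong: if_cong)
  finally show ?thesis .
qed

text \<open>After the first \<open>k\<close> modes have been processed, the index in each of them runs through the positions
  in the chosen set, while the later indices are still those of \<open>T\<close>; induction on \<open>k\<close>.\<close>

lemma subtensor_eq_multi_mode_product:
  fixes T :: "'a::field tensor"
  assumes \<beta>: "is_column_numbering \<beta>" and len: "length Is = length (dims T)"
  shows "subtensor T Is = multi_mode_product \<beta> T (\<lambda>i. row_selector (dims T ! i) (Is ! i))"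
proof -
  define n where "n = length (dims T)"
  define P :: "nat \<Rightarrow> 'a mat" where "P i = row_selector (dims T ! i) (Is ! i)" for i
  define F where "F k = fold (\<lambda>i S. mode_product \<beta> i S (P i)) [0..<k] T" for k
  define e where "e i = card {k. k < dims T ! i \<and> k \<in> Is ! i}" for i
  have row_P: "dim_row (P i) = e i" for i
    by (simp add: P_def e_def carrier_matD[OF row_selector_carrier])
  have F_Suc: "F (Suc k) = mode_product \<beta> k (F k) (P k)" for k
    by (simp add: F_def)
  have lenF [simp]: "length (dims (F k)) = n" for k by (simp add: F_def n_def)
  have dF: "dims (F k) ! j = (if j < k then e j else dims T ! j)" if "k \<le> n" "j < n" for k j
    using that
  proof (induction k)
    case (Suc k)
    then show ?case
      by (auto simp: F_Suc dims_mode_product row_P nth_list_update)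
  qed (simp add: F_def)
  have "entry (F k) is = entry T (map (\<lambda>j. if j < k then pick (Is ! j) (is ! j) else is ! j) [0..<n])"
    if "k \<le> n" "is \<in> multi_indices (dims (F k))" for k "is"
    using that
  proof (induction k arbitrary: "is")
    case 0
    then have "map (\<lambda>j. if j < 0 then pick (Is ! j) (is ! j) else is ! j) [0..<n] = is"
      by (intro nth_equalityI) (auto simp: mem_multi_indices)
    then show ?case by (simp add: F_def)
  next
    case (Suc k)
    then have k: "k < n" by simp
    have dk: "dims (F k) ! k = dims T ! k" using dF[of k k] k by simp
    have mem: "is \<in> multi_indices ((dims (F k))[k := e k])"
      using Suc.prems by (simp add: F_Suc dims_mode_product row_P)
    have li: "length is = n" and "is ! k < e k"
      using mem k by (auto simp: mem_multi_indices dest: spec[of _ k])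
    then have "pick (Is ! k) (is ! k) < dims T ! k" using pick_le unfolding e_def by blast
    then have mem': "is[k := pick (Is ! k) (is ! k)] \<in> multi_indices (dims (F k))"
      using multi_indices_update[OF mem] dk by simp
    have "entry (F (Suc k)) is = entry (F k) (is[k := pick (Is ! k) (is ! k)])"
      using entry_mode_product_row_selector[OF \<beta>, of k "F k" "is" "Is ! k"] k mem
      by (simp add: F_Suc P_def dk e_def)
    also have "\<dots> = entry T (map (\<lambda>j. if j < k then pick (Is ! j) (is[k := pick (Is ! k) (is ! k)] ! j)
        else is[k := pick (Is ! k) (is ! k)] ! j) [0..<n])"
      using Suc.IH[OF _ mem'] k by simp
    also have "map (\<lambda>j. if j < k then pick (Is ! j) (is[k := pick (Is ! k) (is ! k)] ! j)
        else is[k := pick (Is ! k) (is ! k)] ! j) [0..<n]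
      = map (\<lambda>j. if j < Suc k then pick (Is ! j) (is ! j) else is ! j) [0..<n]"
      using li by (intro nth_equalityI) (auto simp: nth_list_update less_Suc_eq)
    finally show ?case .
  qed
  note entry_F = this
  have "subtensor T Is = F n"
  proof (rule tensor_eqI)
    show dims_eq: "dims (subtensor T Is) = dims (F n)"
      using len dF[of n] by (intro nth_equalityI) (auto simp: subtensor_def n_def[symmetric] e_def)
    fix "is" assume "is": "is \<in> multi_indices (dims (F n))"
    then have "length is = n" by (simp add: mem_multi_indices)
    then have "map2 pick Is is = map (\<lambda>j. if j < n then pick (Is ! j) (is ! j) else is ! j) [0..<n]"
      using len by (intro nth_equalityI) (auto simp: n_def[symmetric])
    then show "entry (subtensor T Is) is = entry (F n) is"
      using "is" entry_F[OF order_refl "is"] dims_eq by (simp add: subtensor_def)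
  qed
  then show ?thesis by (simp add: multi_mode_product_def F_def P_def n_def)
qed

section \<open>Ranks of the unfoldings of mode products and subtensors\<close>

text \<open>For \<open>i = j\<close> the unfolding is multiplied by \<open>Y\<close> from the left. For \<open>i \<noteq> j\<close> it is multiplied from the
  right by a matrix \<open>X\<close>: the column of the product belonging to a multi-index is a combination of the
  columns of \<open>S\<close> belonging to the multi-indices that differ from it in the \<open>j\<close>-th place only, with
  coefficients from \<open>Y\<close>.\<close>

lemma mat_rank_unfolding_mode_product_le:
  assumes \<beta>: "is_column_numbering \<beta>" and i: "i < length (dims S)" and j: "j < length (dims S)"
    and Y: "dim_col Y = dims S ! j"
  shows "mat_rank (unfolding_mat \<beta> i (mode_product \<beta> j S Y)) \<le> mat_rank (unfolding_mat \<beta> i S)"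
proof (cases "i = j")
  case True
  then have "Y \<in> carrier_mat (dim_row Y) (dims S ! i)" using Y by auto
  from mat_rank_mult_le_right[OF this unfolding_mat_carrier]
  show ?thesis
    unfolding True[symmetric] unfolding_mode_product[OF \<beta> i] .
next
  case ij: False
  define S' where "S' = mode_product \<beta> j S Y"
  define es where "es = del_nth i (dims S)"
  define es' where "es' = del_nth i (dims S')"
  \<comment> \<open>The multi-index with \<open>i\<close>-th entry \<open>0\<close> belonging to column \<open>c\<close> of the unfolding of \<open>S'\<close>.
    The value \<open>0\<close> is a placeholder that keeps the other entries in place; \<open>del_nth\<close> removes it again.\<close>
  define z where "z c = ins_nth i 0 (inv_into (multi_indices es') (\<beta> i es') c)" for c
  define X where "X = mat (prod_list es) (prod_list es') (\<lambda>(b, c). \<Sum>k<dims S ! j.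
      if b = \<beta> i es (del_nth i ((z c)[j := k])) then Y $$ (z c ! j, k) else 0)"
  have dims': "dims S' = (dims S)[j := dim_row Y]" by (simp add: S'_def dims_mode_product)
  have i': "i < length (dims S')" using i by (simp add: dims')
  have M: "unfolding_mat \<beta> i S \<in> carrier_mat (dims S ! i) (prod_list es)"
    and M': "unfolding_mat \<beta> i S' \<in> carrier_mat (dims S ! i) (prod_list es')"
    using unfolding_mat_carrier[of \<beta> i S] unfolding_mat_carrier[of \<beta> i S'] ij
    by (simp_all add: es_def es'_def dims')
  have X: "X \<in> carrier_mat (prod_list es) (prod_list es')" by (simp add: X_def)
  have "unfolding_mat \<beta> i S' = unfolding_mat \<beta> i S * X"
  proof (rule eq_matI)
    fix a c assume "a < dim_row (unfolding_mat \<beta> i S * X)" "c < dim_col (unfolding_mat \<beta> i S * X)"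
    then have a: "a < dims S ! i" and c: "c < prod_list es'" using M X by auto
    define js where "js = inv_into (multi_indices es') (\<beta> i es') c"
    have js: "js \<in> multi_indices es'" "\<beta> i es' js = c"
      unfolding js_def by (rule column_index[OF \<beta> c])+
    define "is" where "is = ins_nth i a js"
    have mem: "is \<in> multi_indices (dims S')"
      unfolding is_def using a ij i' js(1)
      by (intro multi_indices_ins_nth) (auto simp: es'_def dims')
    have il: "i \<le> length js" using js(1) i' by (simp add: mem_multi_indices es'_def)
    have isi: "is ! i = a" and delis: "del_nth i is = js" using il by (simp_all add: is_def)
    have z: "z c = is[i := 0]"
      using il by (simp add: z_def js_def[symmetric] is_def ins_nth_def list_update_append)
    have zj: "z c ! j = is ! j" using ij by (simp add: z)
    have zk: "del_nth i ((z c)[j := k]) = del_nth i (is[j := k])" for k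
      using ij by (simp add: z list_update_swap[of i j])
    have row: "is ! j < dim_row Y"
      using mem j by (auto simp: mem_multi_indices dims' dest: spec[of _ j])
    have memk: "is[j := k] \<in> multi_indices (dims S)" if "k < dims S ! j" for k
      using multi_indices_update[OF mem[unfolded dims'] that] .
    have colk: "\<beta> i es (del_nth i (is[j := k])) < prod_list es" if "k < dims S ! j" for k
      unfolding es_def by (rule column_number_less(1)[OF \<beta> multi_indices_del_nth[OF i memk[OF that]]])
    have unfk: "entry S (is[j := k]) = unfolding_mat \<beta> i S $$ (a, \<beta> i es (del_nth i (is[j := k])))"
      if "k < dims S ! j" for k
      using unfolding_mat_index[OF \<beta> i memk[OF that]] ij isi by (simp add: es_def)
    have "unfolding_mat \<beta> i S' $$ (a, c) = entry S' is"
      using unfolding_mat_index[OF \<beta> i' mem] isi js(2) delis by (simp add: es'_def)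
    also have "\<dots> = (\<Sum>k<dims S ! j. Y $$ (is ! j, k)
        * unfolding_mat \<beta> i S $$ (a, \<beta> i es (del_nth i (is[j := k]))))"
      using entry_mode_product[OF \<beta> j, of "is" Y] mem row Y
      by (simp add: S'_def[symmetric] dims' unfk)
    also have "\<dots> = (\<Sum>k<dims S ! j. \<Sum>b<prod_list es. unfolding_mat \<beta> i S $$ (a, b)
        * (if b = \<beta> i es (del_nth i (is[j := k])) then Y $$ (is ! j, k) else 0))"
    proof (intro sum.cong refl)
      fix k assume "k \<in> {..<dims S ! j}"
      then have *: "\<beta> i es (del_nth i (is[j := k])) < prod_list es" by (simp add: colk)
      have "(\<Sum>b<prod_list es. unfolding_mat \<beta> i S $$ (a, b)
          * (if b = \<beta> i es (del_nth i (is[j := k])) then Y $$ (is ! j, k) else 0))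
        = (\<Sum>b<prod_list es. if b = \<beta> i es (del_nth i (is[j := k]))
          then Y $$ (is ! j, k) * unfolding_mat \<beta> i S $$ (a, b) else 0)"
        by (intro sum.cong) (simp_all add: mult.commute)
      also have "\<dots> = Y $$ (is ! j, k) * unfolding_mat \<beta> i S $$ (a, \<beta> i es (del_nth i (is[j := k])))"
        using * by (subst sum.delta) simp_all
      finally show "Y $$ (is ! j, k) * unfolding_mat \<beta> i S $$ (a, \<beta> i es (del_nth i (is[j := k])))
        = (\<Sum>b<prod_list es. unfolding_mat \<beta> i S $$ (a, b)
          * (if b = \<beta> i es (del_nth i (is[j := k])) then Y $$ (is ! j, k) else 0))" ..
    qed
    also have "\<dots> = (\<Sum>b<prod_list es. unfolding_mat \<beta> i S $$ (a, b) * X $$ (b, c))"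
      using c by (subst sum.swap) (simp add: X_def zk zj sum_distrib_left cong: if_cong)
    also have "\<dots> = (unfolding_mat \<beta> i S * X) $$ (a, c)"
      using a c M X by (simp add: scalar_prod_def atLeast0LessThan)
    finally show "unfolding_mat \<beta> i S' $$ (a, c) = (unfolding_mat \<beta> i S * X) $$ (a, c)" .
  qed (use M M' X in auto)
  then show ?thesis
    using mat_rank_mult_le_left[OF M X] by (simp add: S'_def)
qed

lemma mat_rank_unfolding_multi_mode_product_le:
  assumes \<beta>: "is_column_numbering \<beta>" and i: "i < length (dims S)"
    and Y: "\<And>j. j < length (dims S) \<Longrightarrow> dim_col (Y j) = dims S ! j"
  shows "mat_rank (unfolding_mat \<beta> i (multi_mode_product \<beta> S Y)) \<le> mat_rank (unfolding_mat \<beta> i S)"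
proof -
  let ?F = "\<lambda>k. fold (\<lambda>i S. mode_product \<beta> i S (Y i)) [0..<k] S"
  have "mat_rank (unfolding_mat \<beta> i (?F k)) \<le> mat_rank (unfolding_mat \<beta> i S)"
    if "k \<le> length (dims S)" for k
    using that
  proof (induction k)
    case (Suc k)
    have "mat_rank (unfolding_mat \<beta> i (?F (Suc k))) \<le> mat_rank (unfolding_mat \<beta> i (?F k))"
      using mat_rank_unfolding_mode_product_le[OF \<beta>, of i "?F k" k "Y k"] i Y[of k] Suc.prems
      by (simp add: dims_fold_mode_product_other)
    with Suc show ?case by simp
  qed simp
  then show ?thesis by (simp add: multi_mode_product_def)
qed

lemma set_cols_unfolding_mat:
  assumes \<beta>: "is_column_numbering \<beta>"
  shows "set (cols (unfolding_mat \<beta> i T))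
     = (\<lambda>js. vec (dims T ! i) (\<lambda>k. entry T (ins_nth i k js))) ` multi_indices (del_nth i (dims T))"
proof -
  let ?es = "del_nth i (dims T)"
  let ?g = "\<lambda>js. vec (dims T ! i) (\<lambda>k. entry T (ins_nth i k js))"
  have "bij_betw (\<beta> i ?es) (multi_indices ?es) {..<prod_list ?es}"
    using \<beta> by (simp add: is_column_numbering_def)
  from bij_betw_imp_surj_on[OF bij_betw_inv_into[OF this]]
  have "?g ` multi_indices ?es = ?g ` inv_into (multi_indices ?es) (\<beta> i ?es) ` {..<prod_list ?es}"
    by (simp only:)
  also have "\<dots> = (\<lambda>c. ?g (inv_into (multi_indices ?es) (\<beta> i ?es) c)) ` {..<prod_list ?es}"
    by (rule image_image)
  also have "\<dots> = col (unfolding_mat \<beta> i T) ` {..<prod_list ?es}"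
    by (intro image_cong refl eq_vecI) (auto simp: unfolding_mat_def Let_def)
  also have "\<dots> = set (cols (unfolding_mat \<beta> i T))"
    by (auto simp: cols_def unfolding_mat_def Let_def)
  finally show ?thesis ..
qed

lemma set_cols_submatrix:
  assumes "J \<subseteq> {..<dim_col A}"
  shows "set (cols (submatrix A I J))
    = (\<lambda>c. vec (card {k. k < dim_row A \<and> k \<in> I}) (\<lambda>k. A $$ (pick I k, c))) ` J"
proof -
  have J: "{c. c < dim_col A \<and> c \<in> J} = J" using assms by auto
  have surj: "pick J ` {..<card J} = J"
  proof (intro equalityI subsetI)
    fix c assume "c \<in> J"
    moreover have "finite J" by (rule finite_subset[OF assms]) simp
    ultimately have "card {a \<in> J. a < c} < card J" by (intro psubset_card_mono) auto
    then show "c \<in> pick J ` {..<card J}"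
      using pick_card_in_set[OF \<open>c \<in> J\<close>] by (intro image_eqI[of c _ "card {a \<in> J. a < c}"]) simp_all
  qed (auto simp: pick_in_set_le)
  have "set (cols (submatrix A I J)) = col (submatrix A I J) ` {..<card J}"
    by (auto simp: cols_def dim_submatrix J)
  also have "\<dots> = (\<lambda>c. vec (card {k. k < dim_row A \<and> k \<in> I}) (\<lambda>k. A $$ (pick I k, pick J c))) ` {..<card J}"
    by (intro image_cong refl eq_vecI) (auto simp: dim_submatrix submatrix_index J)
  also have "\<dots> = (\<lambda>c. vec (card {k. k < dim_row A \<and> k \<in> I}) (\<lambda>k. A $$ (pick I k, c))) ` pick J ` {..<card J}"
    by (simp add: image_image)
  finally show ?thesis by (simp add: surj)
qed

lemma mat_rank_cong_set_cols:
  assumes "dim_row A = dim_row B" "set (cols A) = set (cols B)"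
  shows "mat_rank A = mat_rank B"
  by (simp add: assms vec_space.rank_def)

lemma dims_subtensor:
  assumes len: "length Is = length (dims T)"
    and sub: "\<And>j. j < length (dims T) \<Longrightarrow> Is ! j \<subseteq> {..<dims T ! j}"
  shows "dims (subtensor T Is) = map card Is"
proof -
  have "{k. k < dims T ! j \<and> k \<in> Is ! j} = Is ! j" if "j < length (dims T)" for j
    using sub[OF that] by auto
  then show ?thesis
    using len by (intro nth_equalityI) (auto simp: subtensor_def)
qed

text \<open>The two matrices agree up to the order of their columns, which depends on the numbering \<open>\<beta>\<close>. The
  rank depends only on the set of columns, and both sets consist of the mode-\<open>i\<close> fibres of \<open>T\<close> through
  the multi-indices in the product of the \<open>I\<^sub>j\<close>, cut down to the indices in \<open>I\<^sub>i\<close>.\<close>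

lemma mat_rank_unfolding_subtensor:
  assumes \<beta>: "is_column_numbering \<beta>" and i: "i < length (dims T)"
    and len: "length Is = length (dims T)"
    and sub: "\<And>j. j < length (dims T) \<Longrightarrow> Is ! j \<subseteq> {..<dims T ! j}"
  shows "mat_rank (submatrix (unfolding_mat \<beta> i T) (Is ! i) (column_set \<beta> i T Is))
     = mat_rank (unfolding_mat \<beta> i (subtensor T Is))"
proof (rule mat_rank_cong_set_cols)
  define Js where "Js = del_nth i Is"
  define es where "es = del_nth i (dims T)"
  define g where "g js = vec (card (Is ! i)) (\<lambda>k. entry T (ins_nth i (pick (Is ! i) k) js))" for js
  have dR: "dims (subtensor T Is) = map card Is" by (rule dims_subtensor[OF len sub])
  have Ii: "{k. k < dims T ! i \<and> k \<in> Is ! i} = Is ! i" using sub[OF i] by auto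
  have lenJ: "length Js = length (dims T) - 1" and lenes: "length es = length (dims T) - 1"
    using i len by (simp_all add: Js_def es_def)
  have subJ: "Js ! j \<subseteq> {..<es ! j}" if "j < length Js" for j
    using that sub[of j] sub[of "Suc j"] i len lenJ by (auto simp: Js_def es_def nth_del_nth)
  have finJ: "\<forall>J\<in>set Js. finite J"
    by (metis subJ finite_lessThan finite_subset in_set_conv_nth)
  have lJ_sub: "listset Js \<subseteq> multi_indices es"
    using subJ lenJ lenes
    by (auto simp: mem_multi_indices mem_listset list_all2_conv_all_nth) blast
  have J: "column_set \<beta> i T Is \<subseteq> {..<dim_col (unfolding_mat \<beta> i T)}"
    using lJ_sub column_number_less(1)[OF \<beta>, of _ es i] carrier_matD(2)[OF unfolding_mat_carrier[of \<beta> i T]]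
    by (auto simp: column_set_def Js_def es_def)
  have row: "dim_row (unfolding_mat \<beta> i T) = dims T ! i"
    by (rule carrier_matD(1)[OF unfolding_mat_carrier])
  have "set (cols (submatrix (unfolding_mat \<beta> i T) (Is ! i) (column_set \<beta> i T Is)))
      = (\<lambda>js. vec (card (Is ! i)) (\<lambda>k. unfolding_mat \<beta> i T $$ (pick (Is ! i) k, \<beta> i es js))) ` listset Js"
    unfolding set_cols_submatrix[OF J] row Ii by (simp add: column_set_def image_image Js_def es_def)
  also have "\<dots> = g ` listset Js"
  proof (intro image_cong refl)
    fix js assume "js \<in> listset Js"
    then have js: "js \<in> multi_indices es" using lJ_sub by blast
    have "pick (Is ! i) k < dims T ! i" if "k < card (Is ! i)" for k
      using pick_in_set_le[OF that] sub[OF i] by auto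
    then show "vec (card (Is ! i)) (\<lambda>k. unfolding_mat \<beta> i T $$ (pick (Is ! i) k, \<beta> i es js)) = g js"
      using column_number_less[OF \<beta> js] by (intro eq_vecI) (auto simp: g_def unfolding_mat_def Let_def es_def)
  qed
  also have "\<dots> = (\<lambda>ks. g (map2 pick Js ks)) ` multi_indices (map card Js)"
    unfolding listset_eq_image_pick[OF finJ] by (simp add: image_image)
  also have "\<dots> = (\<lambda>ks. vec (dims (subtensor T Is) ! i) (\<lambda>k. entry (subtensor T Is) (ins_nth i k ks)))
      ` multi_indices (map card Js)"
  proof (intro image_cong refl)
    fix ks assume ks: "ks \<in> multi_indices (map card Js)"
    have "ins_nth i k ks \<in> multi_indices (map card Is)" if "k < card (Is ! i)" for k
      using ks that i len
      by (intro multi_indices_ins_nth) (auto simp: Js_def del_nth_def take_map drop_map)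
    moreover have "length ks = length Is - 1" using ks lenJ len by (simp add: mem_multi_indices)
    ultimately show "g (map2 pick Js ks)
        = vec (dims (subtensor T Is) ! i) (\<lambda>k. entry (subtensor T Is) (ins_nth i k ks))"
      using i len dR by (intro eq_vecI) (auto simp: g_def subtensor_def map2_ins_nth Js_def)
  qed
  also have "\<dots> = set (cols (unfolding_mat \<beta> i (subtensor T Is)))"
    unfolding set_cols_unfolding_mat[OF \<beta>] dR
    by (simp add: dR Js_def del_nth_def take_map drop_map)
  finally show "set (cols (submatrix (unfolding_mat \<beta> i T) (Is ! i) (column_set \<beta> i T Is)))
      = set (cols (unfolding_mat \<beta> i (subtensor T Is)))" .
  show "dim_row (submatrix (unfolding_mat \<beta> i T) (Is ! i) (column_set \<beta> i T Is))
      = dim_row (unfolding_mat \<beta> i (subtensor T Is))"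
    using i len Ii dR by (simp add: dim_submatrix unfolding_mat_def Let_def)
qed

section \<open>Characterizations of the reconstruction from a subtensor\<close>

theorem theorem4p2:
  fixes T :: "'a::field tensor" and \<beta> :: column_numbering
    and Is :: "nat set list" and n :: nat and r :: "nat list"
    and R :: "'a tensor" and C U :: "nat \<Rightarrow> 'a mat"
  assumes "is_column_numbering \<beta>"
    and "length (dims T) = n"
    and "multilinear_rank \<beta> T = r"
    and "length Is = n"
    and "\<And>i. i < n \<Longrightarrow> Is ! i \<subseteq> {..<dims T ! i}"
    and "R = subtensor T Is"
    and "\<And>i. i < n \<Longrightarrow> C i = submatrix (unfolding_mat \<beta> i T) UNIV (column_set \<beta> i T Is)"
    and "\<And>i. i < n \<Longrightarrow> U i = submatrix (C i) (Is ! i) UNIV"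
  shows "let
      cond_i = (\<forall>i<n. mat_rank (U i) = r ! i);
      cond_ii = (\<exists>G. (\<forall>i<n. is_generalized_inverse (U i) (G i)) \<and>
                     T = multi_mode_product \<beta> R (\<lambda>i. C i * G i));
      cond_iii = (\<forall>G. (\<forall>i<n. is_generalized_inverse (U i) (G i)) \<longrightarrow>
                     T = multi_mode_product \<beta> R (\<lambda>i. C i * G i));
      cond_iv = (multilinear_rank \<beta> R = r);
      cond_v = (\<forall>i<n. mat_rank (submatrix (unfolding_mat \<beta> i T) (Is ! i) UNIV) = r ! i)
    in
      (cond_i \<longleftrightarrow> cond_ii) \<and> (cond_i \<longleftrightarrow> cond_iii) \<and> (cond_i \<longleftrightarrow> cond_iv) \<and>
      (cond_i \<or> cond_ii \<or> cond_iii \<or> cond_iv \<longrightarrow>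
        (\<forall>H. (\<forall>i<n. is_generalized_inverse (C i) (H i)) \<longrightarrow>
             T = multi_mode_product \<beta> T (\<lambda>i. C i * H i))) \<and>
      (cond_i \<or> cond_ii \<or> cond_iii \<or> cond_iv \<longrightarrow> cond_v) \<and>
      ((\<exists>\<phi> :: 'a \<Rightarrow> real. field_isom \<phi>) \<or> (\<exists>\<phi> :: 'a \<Rightarrow> complex. field_isom \<phi>) \<longrightarrow>
        (cond_v \<longleftrightarrow> cond_i) \<and> (cond_v \<longleftrightarrow> cond_ii) \<and>
        (cond_v \<longleftrightarrow> cond_iii) \<and> (cond_v \<longleftrightarrow> cond_iv))"
proof -
  note \<beta> = assms(1)
  define M where "M i = unfolding_mat \<beta> i T" for i
  define N where "N i = prod_list (del_nth i (dims T))" for i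
  define J where "J i = column_set \<beta> i T Is" for i
  define P :: "nat \<Rightarrow> 'a mat" where "P i = row_selector (dims T ! i) (Is ! i)" for i
  define S :: "nat \<Rightarrow> 'a mat" where "S i = transpose_mat (row_selector (N i) (J i))" for i
  define p where "p i = card {k. k < dims T ! i \<and> k \<in> Is ! i}" for i
  define s where "s i = card {k. k < N i \<and> k \<in> J i}" for i
  have M: "M i \<in> carrier_mat (dims T ! i) (N i)" for i
    unfolding M_def N_def by (rule unfolding_mat_carrier)
  have P: "P i \<in> carrier_mat (p i) (dims T ! i)" for i
    unfolding P_def p_def by (rule row_selector_carrier)
  have S: "S i \<in> carrier_mat (N i) (s i)" for i
    using row_selector_carrier by (auto simp: S_def s_def)
  have C_eq: "C i = M i * S i" if "i < n" for i
    using that M[of i] by (simp add: assms(7) submatrix_cols_eq_mult M_def S_def J_def)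
  have C: "C i \<in> carrier_mat (dims T ! i) (s i)" if "i < n" for i
    unfolding C_eq[OF that] by (rule mult_carrier_mat[OF M S])
  have U_eq: "U i = P i * C i" if "i < n" for i
    using that C[OF that] by (simp add: assms(8) submatrix_rows_eq_mult P_def)
  have U: "U i \<in> carrier_mat (p i) (s i)" if "i < n" for i
    unfolding U_eq[OF that] by (rule mult_carrier_mat[OF P C[OF that]])
  have U_PMS: "U i = P i * (M i * S i)" if "i < n" for i
    using that by (simp only: U_eq C_eq)
  have PM_eq: "submatrix (unfolding_mat \<beta> i T) (Is ! i) UNIV = P i * M i" for i
    using M[of i] by (simp add: submatrix_rows_eq_mult M_def P_def)
  have PM: "P i * M i \<in> carrier_mat (p i) (N i)" for i by (rule mult_carrier_mat[OF P M])
  have r: "r ! i = mat_rank (M i)" if "i < n" for i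
    using that assms(2,3) by (auto simp: multilinear_rank_def M_def)
  have R_eq: "R = multi_mode_product \<beta> T P"
    using subtensor_eq_multi_mode_product[OF \<beta>, of Is T] assms(2,4,6) by (simp add: P_def[abs_def])
  have dR: "length (dims R) = n" "\<And>i. i < n \<Longrightarrow> dims R ! i = p i"
    using assms(2,4) by (simp_all add: assms(6) subtensor_def p_def)
  have rank_U: "mat_rank (U i) = mat_rank (unfolding_mat \<beta> i R)" if "i < n" for i
    using mat_rank_unfolding_subtensor[OF \<beta>, of i T Is] assms(2,4,5) that
    by (simp add: assms(6-8) submatrix_split[symmetric])
  have rank_U_le: "mat_rank (U i) \<le> mat_rank (P i * M i)" "mat_rank (P i * M i) \<le> mat_rank (M i)"
    if "i < n" for i
    using mat_rank_mult_le_left[OF PM S] mat_rank_mult_le_right[OF P M]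
    unfolding U_PMS[OF that] assoc_mult_mat[OF P M S, symmetric] by blast+

  \<comment> \<open>Each \<open>Y i * P i\<close> acts as the identity on the column space of the mode-\<open>i\<close> unfolding, so that
    multiplying \<open>R\<close> by the \<open>Y i\<close> undoes the selections.\<close>
  have recover: "T = multi_mode_product \<beta> R Y"
    if "\<And>i. i < n \<Longrightarrow> Y i \<in> carrier_mat (dims T ! i) (p i)"
      and "\<And>i. i < n \<Longrightarrow> Y i * P i * M i = M i" for Y
  proof -
    have "multi_mode_product \<beta> R Y = multi_mode_product \<beta> T (\<lambda>i. Y i * P i)"
      unfolding R_eq using that(1) assms(2) by (intro multi_mode_product_multi_mode_product[OF \<beta> P]) simp
    also have "\<dots> = T"
    proof (rule multi_mode_product_ident[OF \<beta>])
      fix i assume "i < length (dims T)"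
      with assms(2) have "i < n" by simp
      then show "dim_row (Y i * P i) = dims T ! i" "Y i * P i * unfolding_mat \<beta> i T = unfolding_mat \<beta> i T"
        using that[of i] by (auto simp: M_def)
    qed
    finally show ?thesis by (rule sym)
  qed
  \<comment> \<open>Any recovery by mode products forces (i), because these do not increase ranks.\<close>
  have recover_imp_i: "\<forall>i<n. mat_rank (U i) = r ! i"
    if Y: "\<And>i. i < n \<Longrightarrow> dim_col (Y i) = p i" and T: "T = multi_mode_product \<beta> R Y" for Y
  proof (intro allI impI)
    fix i assume i: "i < n"
    have "mat_rank (M i) \<le> mat_rank (unfolding_mat \<beta> i R)"
      using mat_rank_unfolding_multi_mode_product_le[OF \<beta>, of i R Y] i Y dR
      by (simp add: T[symmetric] M_def)
    then show "mat_rank (U i) = r ! i"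
      using rank_U[OF i] rank_U_le[OF i] r[OF i] by simp
  qed
  have dim_CG: "C i * G i \<in> carrier_mat (dims T ! i) (p i)"
    if "\<forall>i<n. is_generalized_inverse (U i) (G i)" "i < n" for G i
    using that U[OF that(2)] C[OF that(2)] by (auto simp: is_generalized_inverse_def)

  let ?i = "\<forall>i<n. mat_rank (U i) = r ! i"
  let ?ii = "\<exists>G. (\<forall>i<n. is_generalized_inverse (U i) (G i)) \<and>
                     T = multi_mode_product \<beta> R (\<lambda>i. C i * G i)"
  let ?iii = "\<forall>G. (\<forall>i<n. is_generalized_inverse (U i) (G i)) \<longrightarrow>
                     T = multi_mode_product \<beta> R (\<lambda>i. C i * G i)"
  let ?iv = "multilinear_rank \<beta> R = r"
  let ?v = "\<forall>i<n. mat_rank (submatrix (unfolding_mat \<beta> i T) (Is ! i) UNIV) = r ! i"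
  let ?CC = "\<forall>H. (\<forall>i<n. is_generalized_inverse (C i) (H i)) \<longrightarrow>
             T = multi_mode_product \<beta> T (\<lambda>i. C i * H i)"
  have i_iii: ?iii if "?i"
  proof (intro allI impI)
    fix G assume G: "\<forall>i<n. is_generalized_inverse (U i) (G i)"
    show "T = multi_mode_product \<beta> R (\<lambda>i. C i * G i)"
    proof (rule recover[OF dim_CG[OF G]])
      fix i assume i: "i < n"
      have rank: "mat_rank (P i * (M i * S i)) = mat_rank (M i)"
        using that i r[OF i] unfolding U_PMS[OF i, symmetric] by simp
      have "is_generalized_inverse (P i * (M i * S i)) (G i)"
        using G i unfolding U_PMS[OF i, symmetric] by blast
      from cross_decomposition[OF M P S rank this]
      show "C i * G i * P i * M i = M i" by (simp only: C_eq[OF i])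
    qed
  qed
  have iii_ii: ?ii if ?iii
  proof -
    have "\<forall>i. \<exists>G. is_generalized_inverse (U i) G" using generalized_inverse_exists by blast
    from choice[OF this] obtain G where "\<forall>i. is_generalized_inverse (U i) (G i)" by blast
    with that show ?thesis by blast
  qed
  have ii_i: ?i if ?ii
  proof -
    from that obtain G where G: "\<forall>i<n. is_generalized_inverse (U i) (G i)"
      and T: "T = multi_mode_product \<beta> R (\<lambda>i. C i * G i)" by blast
    show ?thesis by (rule recover_imp_i[OF carrier_matD(2)[OF dim_CG[OF G]] T])
  qed
  have i_iv: "?i \<longleftrightarrow> ?iv"
  proof -
    have "length r = n" using assms(2,3) by (auto simp: multilinear_rank_def)
    then show ?thesis
      using rank_U dR(1) by (auto simp: multilinear_rank_def list_eq_iff_nth_eq)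
  qed
  have i_CC: ?CC if ?i
  proof (intro allI impI)
    fix H assume H: "\<forall>i<n. is_generalized_inverse (C i) (H i)"
    have "multi_mode_product \<beta> T (\<lambda>i. C i * H i) = T"
    proof (rule multi_mode_product_ident[OF \<beta>])
      fix i assume "i < length (dims T)"
      with assms(2) have i: "i < n" by simp
      show "dim_row (C i * H i) = dims T ! i" using C[OF i] by simp
      have Hc: "H i \<in> carrier_mat (s i) (dims T ! i)" and CHC: "C i * H i * C i = C i"
        using H C[OF i] i by (auto simp: is_generalized_inverse_def)
      have "mat_rank (M i) = mat_rank (U i)" using that i r[OF i] by simp
      also have "\<dots> \<le> mat_rank (C i)"
        unfolding U_eq[OF i] by (rule mat_rank_mult_le_right[OF P C[OF i]])
      finally have "mat_rank (M i * S i) = mat_rank (M i)"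
        unfolding C_eq[OF i] using mat_rank_mult_le_left[OF M S] by (rule order_antisym[rotated])
      from right_cancel_of_rank[OF M S this]
      obtain X where X: "X \<in> carrier_mat (s i) (N i)" "C i * X = M i"
        unfolding C_eq[OF i] .
      \<comment> \<open>\<open>C i * H i\<close> fixes the columns of \<open>C i\<close>, and these span the column space of \<open>M i\<close>.\<close>
      have "C i * H i * M i = C i * H i * C i * X"
        unfolding X(2)[symmetric]
        by (rule assoc_mult_mat[OF mult_carrier_mat[OF C[OF i] Hc] C[OF i] X(1), symmetric])
      also have "\<dots> = M i" by (simp only: CHC X(2))
      finally show "C i * H i * unfolding_mat \<beta> i T = unfolding_mat \<beta> i T" by (simp only: M_def)
    qed
    then show "T = multi_mode_product \<beta> T (\<lambda>i. C i * H i)" by (rule sym)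
  qed
  have i_v: ?v if ?i
    unfolding PM_eq
  proof (intro allI impI)
    fix i assume i: "i < n"
    with that rank_U_le[OF i] r[OF i] show "mat_rank (P i * M i) = r ! i" by simp
  qed
  have v_i: ?i if ?v
  proof -
    note v = that
    have "\<exists>Q. Q \<in> carrier_mat (dims T ! i) (p i) \<and> Q * P i * M i = M i" if i: "i < n" for i
    proof -
      have "mat_rank (P i * M i) = mat_rank (M i)" using v i r[OF i] unfolding PM_eq by simp
      from left_cancel_of_rank[OF M P this]
      obtain Q where Q: "Q \<in> carrier_mat (dims T ! i) (p i)" "Q * (P i * M i) = M i" .
      have "Q * P i * M i = M i" unfolding assoc_mult_mat[OF Q(1) P M] by (rule Q(2))
      with Q(1) show ?thesis by blast
    qed
    then have "\<forall>i. \<exists>Q. i < n \<longrightarrow> Q \<in> carrier_mat (dims T ! i) (p i) \<and> Q * P i * M i = M i" by blast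
    from choice[OF this]
    obtain Q where Q: "\<And>i. i < n \<Longrightarrow> Q i \<in> carrier_mat (dims T ! i) (p i)"
      "\<And>i. i < n \<Longrightarrow> Q i * P i * M i = M i" by blast
    show ?thesis by (rule recover_imp_i[OF carrier_matD(2)[OF Q(1)] recover[OF Q]])
  qed
  show ?thesis
    unfolding Let_def using i_iii iii_ii ii_i i_iv i_CC i_v v_i by argo
qed

end
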